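(* For any integer $d \geq 2$, there exist functions $f_n,g_n \colon \{0,1\}^n \rightarrow \{0,1\}$ for $n \in \mathbb{N}$ such that $\{f_n\}_{n \in \mathbb{N}} \in \mathsf{AC}^0_2$, $\{g_n\}_{n \in \mathbb{N}} \in \mathsf{AC}^0_d \setminus \mathsf{AC}^0_{d-1}$, and for every $n \in \mathbb{N}$ and every restriction $\rho$ on $n$ variables such that $f_n^\rho$ is constant, the function $g_n^\rho$ is also constant.
   Context: $\mathsf{AC}^0_d$ denotes the class of families $\{h_n\}_{n\in\mathbb{N}}$ of functions $h_n\colon\{0,1\}^n\to\{0,1\}$ computable by a (non-uniform) family of circuits $(C_n)_{n\in\mathbb{N}}$ of size polynomial in $n$ and depth $d$, where circuits are built from $\wedge$- and $\vee$-gates of unbounded fan-in, with inputs being constants $0,1$ and literals $x_i,\overline{x}_i$ (negations occur only at the inputs), and depth is the maximal number of $\wedge/\vee$-gates on a path from an input to the output. A restriction on $n$ variables is a function $\rho\colon\{0,\dots,n-1\}\to\{0,1,*\}$. For $h\colon\{0,1\}^n\to\{0,1\}$, the restricted function $h^\rho$ has domain $\{0,1\}^{\rho^{-1}(\{*\})}$: given values for the variables $x_i$ with $\rho(i)=*$, it evaluates $h$ on the input obtained by setting every other $x_i$ to $\rho(i)$. *)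

theory Defs
  imports "HOL-Analysis.Analysis" "HOL-Computational_Algebra.Polynomial"
begin

text \<open>
  The cube \<open>{0,1}\<^sup>I\<close> consists of the extensional functions on \<open>I\<close>. A Boolean function on \<open>{0,1}\<^sup>I\<close> is
  represented by a HOL function of which only the values on \<open>cube I\<close> are ever used.
\<close>

definition cube :: "nat set \<Rightarrow> (nat \<Rightarrow> bool) set" where
  "cube I = I \<rightarrow>\<^sub>E UNIV"

text \<open>
  A circuit is a directed acyclic graph, given by its gates in topological order: \<open>Gate j\<close> is the
  output of the \<open>j\<close>-th gate of the list, and each gate is fed only by input nodes and by earlier
  gates. Gates may be reused, so fan-out is unbounded. Fan-in is an arbitrary nonempty set of nodes,
  which \<open>wf_circuit\<close> forces to be finite.
\<close>

datatype node = Const bool | Pos nat | Neg nat | Gate nat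

datatype gate = And (fanin: "node set") | Or (fanin: "node set")

datatype circuit = Circuit (gates: "gate list") (output_node: node)

fun wf_node :: "nat \<Rightarrow> nat \<Rightarrow> node \<Rightarrow> bool" where
  "wf_node n k (Const b) \<longleftrightarrow> True"
| "wf_node n k (Pos i) \<longleftrightarrow> i < n"
| "wf_node n k (Neg i) \<longleftrightarrow> i < n"
| "wf_node n k (Gate j) \<longleftrightarrow> j < k"

definition wf_circuit :: "nat \<Rightarrow> circuit \<Rightarrow> bool" where
  "wf_circuit n C \<longleftrightarrow>
     (\<forall>j < length (gates C). fanin (gates C ! j) \<noteq> {} \<and>
        (\<forall>v \<in> fanin (gates C ! j). wf_node n j v)) \<and>
     wf_node n (length (gates C)) (output_node C)"

text \<open>In \<open>node_val x vs v\<close>, the list \<open>vs\<close> holds the values of the gates evaluated so far.\<close>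

fun node_val :: "(nat \<Rightarrow> bool) \<Rightarrow> bool list \<Rightarrow> node \<Rightarrow> bool" where
  "node_val x vs (Const b) = b"
| "node_val x vs (Pos i) = x i"
| "node_val x vs (Neg i) = (\<not> x i)"
| "node_val x vs (Gate j) = vs ! j"

fun gate_val :: "(nat \<Rightarrow> bool) \<Rightarrow> bool list \<Rightarrow> gate \<Rightarrow> bool" where
  "gate_val x vs (And V) = (\<forall>v \<in> V. node_val x vs v)"
| "gate_val x vs (Or V) = (\<exists>v \<in> V. node_val x vs v)"

definition gate_vals :: "(nat \<Rightarrow> bool) \<Rightarrow> gate list \<Rightarrow> bool list" where
  "gate_vals x gs = foldl (\<lambda>vs g. vs @ [gate_val x vs g]) [] gs"

definition circuit_eval :: "circuit \<Rightarrow> (nat \<Rightarrow> bool) \<Rightarrow> bool" where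
  "circuit_eval C x = node_val x (gate_vals x (gates C)) (output_node C)"

definition circuit_size :: "circuit \<Rightarrow> nat" where
  "circuit_size C = length (gates C)"

text \<open>\<open>path_to gs v k\<close>: some path from an input node to \<open>v\<close> contains exactly \<open>k\<close> gates.\<close>

inductive path_to :: "gate list \<Rightarrow> node \<Rightarrow> nat \<Rightarrow> bool" for gs where
  const: "path_to gs (Const b) 0"
| pos: "path_to gs (Pos i) 0"
| neg: "path_to gs (Neg i) 0"
| gate: "j < length gs \<Longrightarrow> v \<in> fanin (gs ! j) \<Longrightarrow> path_to gs v k \<Longrightarrow> path_to gs (Gate j) (Suc k)"

definition circuit_depth :: "circuit \<Rightarrow> nat" where
  "circuit_depth C = Max {k. path_to (gates C) (output_node C) k}"

text \<open>
  Depth \<open>d\<close> is read as depth at most \<open>d\<close>; asking for exactly \<open>d\<close> defines the same class, since a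
  circuit can be padded with gates of fan-in one.
\<close>

definition AC0 :: "nat \<Rightarrow> (nat \<Rightarrow> (nat \<Rightarrow> bool) \<Rightarrow> bool) set" where
  "AC0 d = {h. \<exists>(C :: nat \<Rightarrow> circuit) (p :: nat poly). \<forall>n.
     wf_circuit n (C n) \<and> circuit_depth (C n) \<le> d \<and> circuit_size (C n) \<le> poly p n \<and>
     (\<forall>x \<in> cube {..<n}. circuit_eval (C n) x = h n x)}"

text \<open>
  A restriction on \<open>n\<close> variables is a function \<open>nat \<Rightarrow> bool option\<close> of which only the values below
  \<open>n\<close> matter; \<open>None\<close> plays the role of \<open>*\<close>.
\<close>

definition free_vars :: "nat \<Rightarrow> (nat \<Rightarrow> bool option) \<Rightarrow> nat set" where
  "free_vars n \<rho> = {i. i < n \<and> \<rho> i = None}"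

definition restricted ::
  "nat \<Rightarrow> (nat \<Rightarrow> bool option) \<Rightarrow> ((nat \<Rightarrow> bool) \<Rightarrow> bool) \<Rightarrow> (nat \<Rightarrow> bool) \<Rightarrow> bool" where
  "restricted n \<rho> h = (\<lambda>y. h (\<lambda>i \<in> {..<n}. case \<rho> i of None \<Rightarrow> y i | Some b \<Rightarrow> b))"

end

theory Submission
  imports Defs
begin

text \<open>
  Call an input paired if \<open>x\<^sub>1 = \<not> x\<^sub>0\<close>, \<open>x\<^sub>3 = \<not> x\<^sub>2\<close>, and so on. Being paired is a conjunction of
  clauses of size two; this is \<open>f\<close>. The function \<open>g\<close> is the conjunction of \<open>f\<close> with a function \<open>h\<close>
  of \<open>x\<^sub>0, x\<^sub>2, x\<^sub>4, \<dots>\<close>. Where \<open>f\<close> is constantly false, so is \<open>g\<close>. Where \<open>f\<close> is constantly true,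
  no variable that belongs to a pair is free, because flipping one member of a pair destroys
  pairedness, so \<open>g\<close> is constant again (\<open>paired_constant_imp\<close>). If \<open>h\<close> is a conjunction of
  circuits of depth \<open>d - 1\<close>, then the clauses can join its output gate and \<open>g\<close> has depth \<open>d\<close>;
  conversely \<open>h\<close> is obtained from \<open>g\<close> by substituting \<open>\<not> y\<^sub>i\<close> for the second member of every pair,
  so \<open>g\<close> is not easier than \<open>h\<close>. Every function of depth \<open>d\<close> has such a conjunctive form up to
  negation. What is left is the depth hierarchy: some family in \<open>AC0 d\<close> is not in \<open>AC0 (d - 1)\<close>.

  The hierarchy is proved without an explicit hard function (\<open>depth_hierarchy\<close>). For every \<open>n\<close>
  let \<open>h\<^sub>n\<close> be a hardest function for depth \<open>d - 1\<close> among those on \<open>n\<close> bits with a depth-\<open>d\<close>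
  circuit of size \<open>n\<close>. If this family had polynomial-size circuits of depth \<open>d - 1\<close>, then a
  fixed polynomial would bound the cost of reducing the depth of any circuit from \<open>d\<close> to
  \<open>d - 1\<close>. Applied to the bottom levels of a circuit repeatedly, this brings circuits of any fixed
  depth down to depth \<open>d - 1\<close> at polynomial cost (\<open>collapse\<close>). Parity contradicts that. On
  \<open>r ^ K\<close> bits it has circuits of depth \<open>2 * K\<close> and size \<open>2 ^ O(r)\<close>, for each fixed \<open>K\<close>
  (\<open>parity_upper_bound\<close>), whereas in depth \<open>D = d - 1\<close> a circuit of size \<open>2 ^ O(r)\<close> can only cope
  with \<open>O(r ^ (2 * D))\<close> bits (\<open>parity_lower_bound\<close>); take \<open>K = 2 * D + 1\<close>.

  The lower bound for parity is the polynomial method of Razborov and Smolensky over the field with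
  three elements. Each gate is approximated by a polynomial that multiplies the degree by \<open>2 * l\<close>
  and errs on at most a fraction \<open>2 ^ - l\<close> of the inputs (\<open>or_approx\<close>), so a small shallow circuit agrees
  with a polynomial of low degree on most inputs. But a set on which parity is a polynomial of low
  degree contains at most half of all inputs (\<open>card_agree_parity_le\<close>), up to a few central
  binomial coefficients.
\<close>

section \<open>Circuits as layered sets of functions\<close>

text \<open>
  Substitution, union and negation of circuits would require renumbering the gates of a list. Here a
  circuit is instead the set of pairs of a level and the function computed there, and a gate may
  use literals and functions of strictly lower levels. Such sets are closed under union.
\<close>

definition lits :: "nat \<Rightarrow> ((nat \<Rightarrow> bool) \<Rightarrow> bool) set" where
  "lits n = {\<lambda>x. node_val x [] v | v. wf_node n 0 v}"

definition conj_of :: "((nat \<Rightarrow> bool) \<Rightarrow> bool) set \<Rightarrow> (nat \<Rightarrow> bool) \<Rightarrow> bool" where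
  "conj_of W x \<longleftrightarrow> (\<forall>w\<in>W. w x)"

definition disj_of :: "((nat \<Rightarrow> bool) \<Rightarrow> bool) set \<Rightarrow> (nat \<Rightarrow> bool) \<Rightarrow> bool" where
  "disj_of W x \<longleftrightarrow> (\<exists>w\<in>W. w x)"

text \<open>
  \<open>avail n F k\<close> consists of the functions that \<open>F\<close> offers in depth at most \<open>k\<close>. Literals are on level
  \<open>0\<close>, and \<open>layered\<close> below forces every gate to a positive level.
\<close>

definition avail ::
  "nat \<Rightarrow> (nat \<times> ((nat \<Rightarrow> bool) \<Rightarrow> bool)) set \<Rightarrow> nat \<Rightarrow> ((nat \<Rightarrow> bool) \<Rightarrow> bool) set" where
  "avail n F k = lits n \<union> {w. \<exists>e\<le>k. (e, w) \<in> F}"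

definition gate_over ::
  "nat \<Rightarrow> (nat \<times> ((nat \<Rightarrow> bool) \<Rightarrow> bool)) set \<Rightarrow> nat \<Rightarrow> ((nat \<Rightarrow> bool) \<Rightarrow> bool) \<Rightarrow> bool"
  where
  "gate_over n F e f \<longleftrightarrow>
     (\<exists>j W. j < e \<and> W \<subseteq> avail n F j \<and> (f = conj_of W \<or> f = disj_of W))"

definition layered :: "nat \<Rightarrow> (nat \<times> ((nat \<Rightarrow> bool) \<Rightarrow> bool)) set \<Rightarrow> bool" where
  "layered n F \<longleftrightarrow> finite F \<and> (\<forall>e f. (e, f) \<in> F \<longrightarrow> gate_over n F e f)"

definition computes :: "nat \<Rightarrow> nat \<Rightarrow> nat \<Rightarrow> ((nat \<Rightarrow> bool) \<Rightarrow> bool) \<Rightarrow> bool" where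
  "computes n k s f \<longleftrightarrow> (\<exists>F. layered n F \<and> card F \<le> s \<and> f \<in> avail n F k)"

lemma gate_overI:
  "j < e \<Longrightarrow> W \<subseteq> avail n F j \<Longrightarrow> f = conj_of W \<or> f = disj_of W \<Longrightarrow> gate_over n F e f"
  unfolding gate_over_def by blast

lemma layeredE:
  assumes "layered n F" "(e, f) \<in> F"
  obtains j W where "j < e" "W \<subseteq> avail n F j" "f = conj_of W \<or> f = disj_of W"
  using assms unfolding layered_def gate_over_def by blast

lemma layeredI:
  assumes "finite F" "\<And>e f. (e, f) \<in> F \<Longrightarrow> gate_over n F e f"
  shows "layered n F"
  using assms unfolding layered_def by blast

lemma lits_iff:
  "f \<in> lits n \<longleftrightarrow>
     (\<exists>b. f = (\<lambda>x. b)) \<or> (\<exists>i<n. f = (\<lambda>x. x i)) \<or> (\<exists>i<n. f = (\<lambda>x. \<not> x i))"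
proof
  assume "f \<in> lits n"
  then obtain v where "f = (\<lambda>x. node_val x [] v)" "wf_node n 0 v"
    unfolding lits_def by blast
  then show "(\<exists>b. f = (\<lambda>x. b)) \<or> (\<exists>i<n. f = (\<lambda>x. x i)) \<or> (\<exists>i<n. f = (\<lambda>x. \<not> x i))"
    by (cases v) auto
next
  have "(\<lambda>x. b) \<in> lits n" for b
    unfolding lits_def by (rule CollectI, rule exI[of _ "Const b"]) simp
  moreover have "(\<lambda>x. x i) \<in> lits n" if "i < n" for i
    unfolding lits_def using that by (intro CollectI exI[of _ "Pos i"]) simp
  moreover have "(\<lambda>x. \<not> x i) \<in> lits n" if "i < n" for i
    unfolding lits_def using that by (intro CollectI exI[of _ "Neg i"]) simp
  moreover assume "(\<exists>b. f = (\<lambda>x. b)) \<or> (\<exists>i<n. f = (\<lambda>x. x i)) \<or> (\<exists>i<n. f = (\<lambda>x. \<not> x i))"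
  ultimately show "f \<in> lits n" by blast
qed

lemma lits_const: "(\<lambda>x. b) \<in> lits n"
  unfolding lits_iff by blast

lemma lits_pos: "i < n \<Longrightarrow> (\<lambda>x. x i) \<in> lits n"
  unfolding lits_iff by (intro disjI2 disjI1 exI[of _ i]) simp

lemma lits_neg: "i < n \<Longrightarrow> (\<lambda>x. \<not> x i) \<in> lits n"
  unfolding lits_iff by (intro disjI2 exI[of _ i]) simp

lemma lits_not: "f \<in> lits n \<Longrightarrow> (\<lambda>x. \<not> f x) \<in> lits n"
  unfolding lits_iff by fastforce

lemma lits_mono: "n \<le> n' \<Longrightarrow> lits n \<subseteq> lits n'"
  unfolding lits_iff subset_iff by (meson order_less_le_trans)

lemma avail_mono: "n \<le> n' \<Longrightarrow> F \<subseteq> F' \<Longrightarrow> k \<le> k' \<Longrightarrow> avail n F k \<subseteq> avail n' F' k'"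
  unfolding avail_def using lits_mono[of n n'] by (auto dest: order_trans)

lemma avail_lit: "w \<in> lits n \<Longrightarrow> w \<in> avail n F k"
  unfolding avail_def by simp

lemma avail_gate: "(e, w) \<in> F \<Longrightarrow> e \<le> k \<Longrightarrow> w \<in> avail n F k"
  unfolding avail_def by auto

lemma availE:
  assumes "w \<in> avail n F k"
  obtains "w \<in> lits n" | e where "e \<le> k" "(e, w) \<in> F"
  using assms unfolding avail_def by auto

lemma layered_empty: "layered n {}"
  unfolding layered_def by simp

lemma layered_Union:
  assumes "finite A" "\<And>a. a \<in> A \<Longrightarrow> layered n (B a)"
  shows "layered n (\<Union>a\<in>A. B a)"
proof (rule layeredI)
  show "finite (\<Union>a\<in>A. B a)" using assms unfolding layered_def by auto
next
  fix e f assume "(e, f) \<in> (\<Union>a\<in>A. B a)"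
  then obtain a where a: "a \<in> A" "(e, f) \<in> B a" by blast
  obtain j W where "j < e" "W \<subseteq> avail n (B a) j" "f = conj_of W \<or> f = disj_of W"
    using layeredE[OF assms(2)[OF a(1)] a(2)] .
  moreover have "avail n (B a) j \<subseteq> avail n (\<Union>a\<in>A. B a) j"
    using a by (intro avail_mono) auto
  ultimately show "gate_over n (\<Union>a\<in>A. B a) e f"
    by (blast intro: gate_overI)
qed

lemma layered_Un:
  assumes "layered n F" "layered n G"
  shows "layered n (F \<union> G)"
proof -
  have "layered n (\<Union>b\<in>{True, False}. if b then F else G)"
    using assms by (intro layered_Union) auto
  also have "(\<Union>b\<in>{True, False}. if b then F else G) = F \<union> G" by auto
  finally show ?thesis .
qed

lemma layered_insert:
  assumes "layered n F" "j < e" "W \<subseteq> avail n F j" "f = conj_of W \<or> f = disj_of W"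
  shows "layered n (insert (e, f) F)"
proof (rule layeredI)
  show "finite (insert (e, f) F)" using assms unfolding layered_def by auto
next
  fix e' f' assume *: "(e', f') \<in> insert (e, f) F"
  obtain j' W' where "j' < e'" "W' \<subseteq> avail n F j'" "f' = conj_of W' \<or> f' = disj_of W'"
    using * assms layeredE[OF assms(1), of e' f'] by blast
  moreover have "avail n F j' \<subseteq> avail n (insert (e, f) F) j'" by (intro avail_mono) auto
  ultimately show "gate_over n (insert (e, f) F) e' f'"
    by (blast intro: gate_overI)
qed

lemma layered_finite: "layered n F \<Longrightarrow> finite F"
  unfolding layered_def by simp

lemma computes_lit: "f \<in> lits n \<Longrightarrow> computes n k s f"
  unfolding computes_def avail_def using layered_empty[of n] by (intro exI[of _ "{}"]) auto

text \<open>
  Substitution of literals for variables and negation are both applied to a circuit function by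
  function. The two share the following property: gates go to gates, where the type of a gate may
  change (De Morgan).
\<close>

definition gatewise ::
  "nat \<Rightarrow> nat \<Rightarrow> (((nat \<Rightarrow> bool) \<Rightarrow> bool) \<Rightarrow> ((nat \<Rightarrow> bool) \<Rightarrow> bool)) \<Rightarrow> bool" where
  "gatewise n n' \<Phi> \<longleftrightarrow> \<Phi> ` lits n \<subseteq> lits n' \<and>
     (\<forall>W. {\<Phi> (conj_of W), \<Phi> (disj_of W)} \<subseteq> {conj_of (\<Phi> ` W), disj_of (\<Phi> ` W)})"

lemma gatewise_subst:
  assumes "(\<lambda>f x. f (\<sigma> x)) ` lits n \<subseteq> lits n'"
  shows "gatewise n n' (\<lambda>f x. f (\<sigma> x))"
proof -
  have "(\<lambda>x. conj_of W (\<sigma> x)) = conj_of ((\<lambda>f x. f (\<sigma> x)) ` W)" for W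
    by (simp add: conj_of_def fun_eq_iff)
  moreover have "(\<lambda>x. disj_of W (\<sigma> x)) = disj_of ((\<lambda>f x. f (\<sigma> x)) ` W)" for W
    by (simp add: disj_of_def fun_eq_iff)
  ultimately show ?thesis unfolding gatewise_def using assms by simp
qed

lemma gatewise_not: "gatewise n n (\<lambda>f x. \<not> f x)"
proof -
  have "(\<lambda>x. \<not> conj_of W x) = disj_of ((\<lambda>f x. \<not> f x) ` W)" for W
    by (simp add: conj_of_def disj_of_def fun_eq_iff)
  moreover have "(\<lambda>x. \<not> disj_of W x) = conj_of ((\<lambda>f x. \<not> f x) ` W)" for W
    by (simp add: conj_of_def disj_of_def fun_eq_iff)
  moreover have "(\<lambda>f x. \<not> f x) ` lits n \<subseteq> lits n"
    by (rule image_subsetI) (rule lits_not)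
  ultimately show ?thesis unfolding gatewise_def by simp
qed

lemma avail_gatewise:
  assumes "gatewise n n' \<Phi>" "w \<in> avail n F k"
  shows "\<Phi> w \<in> avail n' (map_prod id \<Phi> ` F) k"
  using assms(2)
proof (cases rule: availE)
  case 1
  then have "\<Phi> w \<in> lits n'" using assms(1) unfolding gatewise_def by blast
  then show ?thesis by (rule avail_lit)
next
  case (2 e)
  have "map_prod id \<Phi> (e, w) \<in> map_prod id \<Phi> ` F" using 2(2) by (rule imageI)
  then have "(e, \<Phi> w) \<in> map_prod id \<Phi> ` F" by (simp only: map_prod_simp id_apply)
  then show ?thesis using 2(1) by (rule avail_gate)
qed

lemma layered_gatewise:
  assumes "layered n F" "gatewise n n' \<Phi>"
  shows "layered n' (map_prod id \<Phi> ` F)"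
proof (rule layeredI)
  show "finite (map_prod id \<Phi> ` F)" using layered_finite[OF assms(1)] by simp
next
  fix e g assume "(e, g) \<in> map_prod id \<Phi> ` F"
  then obtain f where p: "g = \<Phi> f" "(e, f) \<in> F" by auto
  obtain j W where j: "j < e" "W \<subseteq> avail n F j" "f = conj_of W \<or> f = disj_of W"
    using layeredE[OF assms(1) p(2)] .
  have "\<Phi> ` W \<subseteq> avail n' (map_prod id \<Phi> ` F) j"
    using avail_gatewise[OF assms(2)] j(2) by blast
  moreover have "g = conj_of (\<Phi> ` W) \<or> g = disj_of (\<Phi> ` W)"
    using j(3) assms(2) unfolding p(1) gatewise_def by blast
  ultimately show "gate_over n' (map_prod id \<Phi> ` F) e g"
    by (rule gate_overI[OF j(1)])
qed

lemma computes_gatewise: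
  assumes "computes n k s f" "gatewise n n' \<Phi>"
  shows "computes n' k s (\<Phi> f)"
proof -
  obtain F where F: "layered n F" "card F \<le> s" "f \<in> avail n F k"
    using assms(1) unfolding computes_def by blast
  have "card (map_prod id \<Phi> ` F) \<le> s"
    by (rule le_trans[OF card_image_le[OF layered_finite[OF F(1)]] F(2)])
  then show ?thesis
    unfolding computes_def
    using layered_gatewise[OF F(1) assms(2)] avail_gatewise[OF assms(2) F(3)]
    by (intro exI[of _ "map_prod id \<Phi> ` F"] conjI)
qed

lemma computes_subst:
  assumes "computes n k s f" "(\<lambda>f x. f (\<sigma> x)) ` lits n \<subseteq> lits n'"
  shows "computes n' k s (\<lambda>x. f (\<sigma> x))"
proof -
  have "gatewise n n' (\<lambda>f x. f (\<sigma> x))" using assms(2) by (rule gatewise_subst)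
  from computes_gatewise[OF assms(1) this] show ?thesis .
qed

lemma computes_not:
  assumes "computes n k s f"
  shows "computes n k s (\<lambda>x. \<not> f x)"
  using computes_gatewise[OF assms gatewise_not] .

lemma computes_mono:
  assumes "computes n k s f" "n \<le> n'" "k \<le> k'" "s \<le> s'"
  shows "computes n' k' s' f"
proof -
  obtain F where F: "layered n F" "card F \<le> s" "f \<in> avail n F k"
    using assms(1) unfolding computes_def by blast
  have "layered n' F"
    using F(1) avail_mono[OF assms(2) order_refl order_refl, of F]
    unfolding layered_def gate_over_def by blast
  then show ?thesis
    unfolding computes_def using F assms avail_mono[OF assms(2) order_refl assms(3)]
    by (intro exI[of _ F]) auto
qed

lemma avail_local:
  assumes "layered n F" "\<forall>i<n. x i = y i"
  shows "\<forall>f\<in>avail n F k. f x = f y"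
proof (induction k rule: less_induct)
  case (less k)
  show ?case
  proof
    fix f assume f: "f \<in> avail n F k"
    from f show "f x = f y"
    proof (cases rule: availE)
      case 1
      then show ?thesis using assms(2) unfolding lits_iff by auto
    next
      case e: (2 e)
      obtain j W where j: "j < e" "W \<subseteq> avail n F j" "f = conj_of W \<or> f = disj_of W"
        using layeredE[OF assms(1) e(2)] .
      have "j < k" using j(1) e(1) by simp
      then have "\<forall>w\<in>W. w x = w y" using less.IH j(2) by blast
      then show ?thesis using j(3) unfolding conj_of_def disj_of_def by blast
    qed
  qed
qed

lemma computes_local:
  assumes "computes n k s f" "\<And>i. i < n \<Longrightarrow> x i = y i"
  shows "f x = f y"
proof -
  obtain F where F: "layered n F" "f \<in> avail n F k"
    using assms(1) unfolding computes_def by blast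
  have "\<forall>i<n. x i = y i" using assms(2) by blast
  then show ?thesis using avail_local[OF F(1)] F(2) by blast
qed

lemma computes_gate:
  assumes "finite W" "\<And>w. w \<in> W \<Longrightarrow> computes n k s w" "f = conj_of W \<or> f = disj_of W"
  shows "computes n (Suc k) (Suc (card W * s)) f"
proof -
  obtain F where F: "\<And>w. w \<in> W \<Longrightarrow> layered n (F w) \<and> card (F w) \<le> s \<and> w \<in> avail n (F w) k"
    using assms(2) unfolding computes_def by metis
  define G where "G = (\<Union>w\<in>W. F w)"
  have "card G \<le> (\<Sum>w\<in>W. card (F w))"
    unfolding G_def using assms(1) by (rule card_UN_le)
  also have "\<dots> \<le> (\<Sum>w\<in>W. s)" using F by (intro sum_mono) blast
  finally have "Suc (card G) \<le> Suc (card W * s)" by simp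
  moreover have "card (insert (Suc k, f) G) \<le> Suc (card G)"
    by (cases "finite G") (auto simp: card_insert_if)
  ultimately have "card (insert (Suc k, f) G) \<le> Suc (card W * s)" by linarith
  moreover have "layered n G" unfolding G_def using assms(1) F by (intro layered_Union) blast+
  have "W \<subseteq> avail n G k"
  proof
    fix w assume "w \<in> W"
    then have "avail n (F w) k \<subseteq> avail n G k" unfolding G_def by (intro avail_mono) auto
    then show "w \<in> avail n G k" using F \<open>w \<in> W\<close> by blast
  qed
  then have "layered n (insert (Suc k, f) G)"
    using \<open>layered n G\<close> assms(3) by (intro layered_insert[of n G k]) auto
  moreover have "f \<in> avail n (insert (Suc k, f) G) (Suc k)" unfolding avail_def by auto
  ultimately show ?thesis unfolding computes_def by blast
qed

section \<open>Correspondence with circuits\<close>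

lemma gate_vals_snoc:
  "gate_vals x (gs @ [g]) = gate_vals x gs @ [gate_val x (gate_vals x gs) g]"
  unfolding gate_vals_def by simp

lemma length_gate_vals: "length (gate_vals x gs) = length gs"
  by (induction gs rule: rev_induct) (simp_all add: gate_vals_snoc, simp add: gate_vals_def)

lemma node_val_cong:
  assumes "wf_node n j v" "\<And>i. i < j \<Longrightarrow> vs ! i = vs' ! i"
  shows "node_val x vs v = node_val x vs' v"
  using assms by (cases v) auto

lemma gate_val_cong:
  assumes "\<forall>v \<in> fanin g. wf_node n j v" "\<And>i. i < j \<Longrightarrow> vs ! i = vs' ! i"
  shows "gate_val x vs g = gate_val x vs' g"
proof -
  have "node_val x vs v = node_val x vs' v" if "v \<in> fanin g" for v
    using node_val_cong assms that by blast
  then show ?thesis by (cases g) auto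
qed

lemma gate_vals_nth:
  assumes "\<forall>j<length gs. \<forall>v \<in> fanin (gs ! j). wf_node n j v" "j < length gs"
  shows "gate_vals x gs ! j = gate_val x (gate_vals x gs) (gs ! j)"
  using assms
proof (induction gs rule: rev_induct)
  case Nil
  then show ?case by simp
next
  case (snoc g gs)
  let ?v = "gate_vals x gs"
  have pre: "gate_vals x (gs @ [g]) ! i = ?v ! i" if "i < length gs" for i
    using that by (simp add: gate_vals_snoc nth_append length_gate_vals)
  have wf: "\<forall>v \<in> fanin ((gs @ [g]) ! j). wf_node n j v" using snoc.prems by blast
  show ?case
  proof (cases "j < length gs")
    case True
    have "\<forall>j<length gs. \<forall>v \<in> fanin (gs ! j). wf_node n j v"
      using snoc.prems(1) by (auto simp: nth_append split: if_splits)
    then have "gate_vals x (gs @ [g]) ! j = gate_val x ?v ((gs @ [g]) ! j)"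
      using snoc.IH True pre by (simp add: nth_append)
    also have "\<dots> = gate_val x (gate_vals x (gs @ [g])) ((gs @ [g]) ! j)"
      using True pre by (intro gate_val_cong[OF wf]) auto
    finally show ?thesis .
  next
    case False
    then have j: "j = length gs" using snoc.prems(2) by simp
    have "gate_vals x (gs @ [g]) ! j = gate_val x ?v ((gs @ [g]) ! j)"
      using j by (simp add: gate_vals_snoc nth_append length_gate_vals)
    also have "\<dots> = gate_val x (gate_vals x (gs @ [g])) ((gs @ [g]) ! j)"
      using j pre by (intro gate_val_cong[OF wf]) auto
    finally show ?thesis .
  qed
qed

definition paths :: "gate list \<Rightarrow> node \<Rightarrow> nat set" where
  "paths gs v = {k. path_to gs v k}"

text \<open>
  The depth of a circuit is a maximum, which is meaningful only for finite nonempty sets of path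
  lengths. The order of the gate list bounds the lengths, and nonempty fan-ins yield a path.
\<close>

lemma paths_finite_nonempty:
  assumes wf: "\<forall>j<length gs. fanin (gs ! j) \<noteq> {} \<and> (\<forall>v \<in> fanin (gs ! j). wf_node n j v)"
    and v: "wf_node n (length gs) v"
  shows "finite (paths gs v)" "paths gs v \<noteq> {}"
proof -
  have b: "path_to gs v k \<Longrightarrow> wf_node n j v \<Longrightarrow> k \<le> j" for v k j
  proof (induction arbitrary: j rule: path_to.induct)
    case (gate i v k)
    then have "k \<le> i" using wf by blast
    then show ?case using gate.prems by simp
  qed auto
  show "finite (paths gs v)"
    unfolding paths_def using b v by (auto simp: finite_nat_set_iff_bounded_le)
  have ne: "j < length gs \<Longrightarrow> \<exists>k. path_to gs (Gate j) k" for j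
  proof (induction j rule: less_induct)
    case (less j)
    then obtain v where v: "v \<in> fanin (gs ! j)" "wf_node n j v" using wf by blast
    have "\<exists>k. path_to gs v k"
      using v less by (cases v) (auto intro: path_to.intros)
    then show ?case using path_to.gate[OF less.prems v(1)] by blast
  qed
  show "paths gs v \<noteq> {}"
    unfolding paths_def using v ne by (cases v) (auto intro: path_to.intros)
qed

text \<open>
  The level of a gate is its depth, the maximal number of gates on a path to it.
\<close>

lemma computes_circuit_eval:
  assumes "wf_circuit n C" "circuit_depth C \<le> k"
  shows "computes n k (circuit_size C) (circuit_eval C)"
proof -
  obtain gs out where C: "C = Circuit gs out" by (cases C)
  have wf: "\<forall>j<length gs. fanin (gs ! j) \<noteq> {} \<and> (\<forall>v \<in> fanin (gs ! j). wf_node n j v)"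
    and out: "wf_node n (length gs) out"
    using assms(1) unfolding wf_circuit_def C by auto
  define dep where "dep v = Max (paths gs v)" for v
  define fn where "fn v = (\<lambda>x. node_val x (gate_vals x gs) v)" for v
  define F where "F = (\<lambda>j. (dep (Gate j), fn (Gate j))) ` {..<length gs}"
  have avail: "fn v \<in> avail n F j"
    if "wf_node n (length gs) v" "dep v \<le> j" for v j
  proof (cases "wf_node n 0 v")
    case True
    have "fn v = (\<lambda>x. node_val x [] v)"
      unfolding fn_def using True by (cases v) auto
    then show ?thesis using True unfolding avail_def lits_def by blast
  next
    case False
    then obtain i where "v = Gate i" "i < length gs"
      using \<open>wf_node n (length gs) v\<close> False by (cases v) auto
    then show ?thesis using that(2) unfolding avail_def F_def by auto
  qed
  have "layered n F"
  proof (rule layeredI)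
    show "finite F" unfolding F_def by simp
  next
    fix e f assume "(e, f) \<in> F"
    then obtain j where j: "j < length gs" "e = dep (Gate j)" "f = fn (Gate j)"
      unfolding F_def by auto
    have wfj: "wf_node n (length gs) v" if "v \<in> fanin (gs ! j)" for v
    proof -
      have "wf_node n j v" using wf that j by blast
      then show ?thesis using j(1) by (cases v) auto
    qed
    have dep_less: "dep v < dep (Gate j)" if v: "v \<in> fanin (gs ! j)" for v
    proof -
      have "dep v \<in> paths gs v"
        unfolding dep_def using paths_finite_nonempty[OF wf wfj[OF v]] by (rule Max_in)
      then have "Suc (dep v) \<in> paths gs (Gate j)"
        unfolding paths_def using path_to.gate[OF j(1) v] by simp
      then have "Suc (dep v) \<le> dep (Gate j)"
        unfolding dep_def using paths_finite_nonempty(1)[OF wf, of "Gate j"] j(1) by simp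
      then show ?thesis by simp
    qed
    define W where "W = fn ` fanin (gs ! j)"
    have "dep (Gate j) > 0" using wf j(1) dep_less by fastforce
    moreover have "W \<subseteq> avail n F (dep (Gate j) - 1)"
      unfolding W_def using avail[OF wfj] dep_less by fastforce
    moreover have "fn (Gate j) = conj_of W \<or> fn (Gate j) = disj_of W"
    proof -
      have "fn (Gate j) x = gate_val x (gate_vals x gs) (gs ! j)" for x
        unfolding fn_def using gate_vals_nth[of gs n j x] wf j(1) by simp
      then show ?thesis
        unfolding W_def fn_def conj_of_def disj_of_def fun_eq_iff by (cases "gs ! j") auto
    qed
    ultimately show "gate_over n F e f"
      unfolding j(2,3) by (intro gate_overI[of "dep (Gate j) - 1"]) auto
  qed
  moreover have "card F \<le> circuit_size C"
    unfolding F_def circuit_size_def C using card_image_le[of "{..<length gs}"] by simp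
  moreover have "circuit_eval C \<in> avail n F k"
  proof -
    have "circuit_eval C = fn out" unfolding fn_def circuit_eval_def C by auto
    moreover have "dep out \<le> k"
      using assms(2) unfolding circuit_depth_def dep_def paths_def C by simp
    ultimately show ?thesis using avail[OF out] by simp
  qed
  ultimately show ?thesis unfolding computes_def by blast
qed

text \<open>
  Listing the pairs by increasing level gives a topological order. Every path to a gate has at most
  as many gates as the level of that gate says, since levels strictly decrease along a wire.
\<close>

lemma computes_imp_circuit:
  assumes "computes n k s f"
  obtains C where "wf_circuit n C" "circuit_depth C \<le> k" "circuit_size C \<le> s"
    "circuit_eval C = f"
proof -
  obtain F where F: "layered n F" "card F \<le> s" "f \<in> avail n F k"
    using assms unfolding computes_def by blast
  obtain ys where ys: "set ys = F" "distinct ys"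
    using finite_distinct_list[OF layered_finite[OF F(1)]] by blast
  define xs where "xs = sort_key fst ys"
  have xs: "set xs = F" "length xs = card F" "sorted (map fst xs)"
    using ys unfolding xs_def by (auto simp: distinct_card)
  define fn where "fn v = (case v of Gate i \<Rightarrow> snd (xs ! i) | _ \<Rightarrow> (\<lambda>x. node_val x [] v))" for v
  define lev where "lev v = (case v of Gate i \<Rightarrow> fst (xs ! i) | _ \<Rightarrow> 0)" for v
  have node_ex: "\<exists>v. wf_node n (length xs) v \<and> fn v = w \<and> lev v \<le> j" if "w \<in> avail n F j" for w j
  proof (cases "w \<in> lits n")
    case True
    then obtain v where "wf_node n 0 v" "w = (\<lambda>x. node_val x [] v)" unfolding lits_def by blast
    then show ?thesis
      by (intro exI[of _ v]) (cases v; auto simp: fn_def lev_def)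
  next
    case False
    then obtain e where e: "e \<le> j" "(e, w) \<in> F" using \<open>w \<in> avail n F j\<close> unfolding avail_def by auto
    then obtain i where "i < length xs" "xs ! i = (e, w)" using xs(1) by (metis in_set_conv_nth)
    then show ?thesis using e(1) by (intro exI[of _ "Gate i"]) (auto simp: fn_def lev_def)
  qed
  have node_val_fn: "node_val x vs v = fn v x"
    if "wf_node n i v" "\<And>j. j < i \<Longrightarrow> vs ! j = snd (xs ! j) x" for v vs x i
    using that by (cases v) (auto simp: fn_def)
  define good where "good i g \<longleftrightarrow> fanin g \<noteq> {} \<and>
     (\<forall>v\<in>fanin g. wf_node n i v \<and> lev v < fst (xs ! i)) \<and>
     (\<forall>x vs. (\<forall>j<i. vs ! j = snd (xs ! j) x) \<longrightarrow> gate_val x vs g = snd (xs ! i) x)" for i g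
  have "\<exists>g. good i g" if i: "i < length xs" for i
  proof -
    obtain e h where eh: "xs ! i = (e, h)" by fastforce
    have "(e, h) \<in> F" using i eh xs(1) nth_mem by metis
    obtain j W where j: "j < e" "W \<subseteq> avail n F j" "h = conj_of W \<or> h = disj_of W"
      using layeredE[OF F(1) \<open>(e, h) \<in> F\<close>] .
    define V where "V = {v. wf_node n i v \<and> lev v < e \<and> fn v \<in> W}"
    have W: "fn ` V = W"
    proof (intro equalityI subsetI)
      fix w assume "w \<in> W"
      then obtain v where v: "wf_node n (length xs) v" "fn v = w" "lev v \<le> j"
        using node_ex[of w j] j(2) by blast
      have "wf_node n i v"
      proof (cases v)
        case (Gate a)
        have "fst (xs ! a) < fst (xs ! i)" using v(3) j(1) eh Gate by (simp add: lev_def)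
        then have "\<not> i \<le> a"
          using sorted_nth_mono[OF xs(3), of i a] v(1) Gate by auto
        then show ?thesis using Gate by simp
      qed (use v(1) in auto)
      then show "w \<in> fn ` V" using \<open>w \<in> W\<close> v j(1) unfolding V_def by auto
    qed (auto simp: V_def)
    have wfV: "wf_node n i v \<and> lev v < e" if "v \<in> insert (Const b) V" for v b
      using that j(1) unfolding V_def by (auto simp: lev_def)
    have val: "node_val x vs v = fn v x"
      if "v \<in> V" "\<forall>j<i. vs ! j = snd (xs ! j) x" for v vs x
      using that wfV node_val_fn by blast
    \<comment> \<open>A neutral constant keeps the fan-in nonempty when \<open>W\<close> is empty.\<close>
    from j(3) show ?thesis
    proof
      assume h: "h = conj_of W"
      have "good i (And (insert (Const True) V))"
        unfolding good_def using wfV val eh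
        by (auto simp: h conj_of_def W[symmetric])
      then show ?thesis by blast
    next
      assume h: "h = disj_of W"
      have "good i (Or (insert (Const False) V))"
        unfolding good_def using wfV val eh
        by (auto simp: h disj_of_def W[symmetric])
      then show ?thesis by blast
    qed
  qed
  then obtain G where G: "\<And>i. i < length xs \<Longrightarrow> good i (G i)" by metis
  define gs where "gs = map G [0..<length xs]"
  have gs: "length gs = length xs" "\<And>i. i < length xs \<Longrightarrow> gs ! i = G i"
    unfolding gs_def by auto
  obtain out where out: "wf_node n (length xs) out" "fn out = f" "lev out \<le> k"
    using node_ex[OF F(3)] by blast
  have wf: "\<forall>j<length gs. fanin (gs ! j) \<noteq> {} \<and> (\<forall>v \<in> fanin (gs ! j). wf_node n j v)"
    using G gs unfolding good_def by auto
  have wfout: "wf_node n (length gs) out" using out gs by simp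
  have vals: "i < length xs \<Longrightarrow> gate_vals x gs ! i = snd (xs ! i) x" for i x
  proof (induction i rule: less_induct)
    case (less i)
    have "gate_vals x gs ! i = gate_val x (gate_vals x gs) (G i)"
      using gate_vals_nth[of gs n i x] wf gs less.prems by auto
    also have "\<dots> = snd (xs ! i) x"
      using G[OF less.prems] less unfolding good_def by auto
    finally show ?case .
  qed
  have path: "path_to gs v l \<Longrightarrow> l \<le> lev v" for v l
  proof (induction rule: path_to.induct)
    case (gate j v l)
    then have "lev v < fst (xs ! j)" using G[of j] gs unfolding good_def by auto
    then show ?case using gate.IH by (simp add: lev_def)
  qed (auto simp: lev_def)
  show thesis
  proof (rule that[of "Circuit gs out"])
    show "wf_circuit n (Circuit gs out)" unfolding wf_circuit_def using wf wfout by simp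
    show "circuit_size (Circuit gs out) \<le> s" unfolding circuit_size_def using gs xs F by simp
    have "circuit_eval (Circuit gs out) x = f x" for x
      unfolding circuit_eval_def using node_val_fn[OF wfout] vals gs out by simp
    then show "circuit_eval (Circuit gs out) = f" by blast
    have "circuit_depth (Circuit gs out) \<in> paths gs out"
      unfolding circuit_depth_def using Max_in[OF paths_finite_nonempty[OF wf wfout]]
      by (simp add: paths_def)
    then show "circuit_depth (Circuit gs out) \<le> k"
      using path out(3) unfolding paths_def by fastforce
  qed
qed

lemma nat_poly_bound: "\<exists>c. \<forall>n. poly (p :: nat poly) n \<le> (n + 2) ^ c"
proof (induction p)
  case 0
  then show ?case by simp
next
  case (pCons a p)
  then obtain c where c: "\<And>n. poly p n \<le> (n + 2) ^ c" by blast
  have "poly (pCons a p) n \<le> (n + 2) ^ (a + c + 1)" for n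
  proof -
    have "a \<le> 2 ^ a" by (simp add: less_imp_le)
    also have "\<dots> \<le> (n + 2) ^ a" by (rule power_mono) auto
    also have "\<dots> \<le> (n + 2) ^ (a + c)" by (rule power_increasing) auto
    finally have 1: "a \<le> (n + 2) ^ (a + c)" .
    have "poly p n \<le> (n + 2) ^ (a + c)"
      by (rule le_trans[OF c power_increasing]) auto
    then have "n * poly p n \<le> n * (n + 2) ^ (a + c)" by (rule mult_le_mono2)
    moreover have "(n + 2) ^ (a + c + 1) = n * (n + 2) ^ (a + c) + 2 * (n + 2) ^ (a + c)"
      by (simp add: algebra_simps)
    ultimately show ?thesis using 1 by (simp only: poly_pCons)
  qed
  then show ?case by blast
qed

text \<open>
  The bounds \<open>(n + 2) ^ c\<close> are cofinal among polynomials and form a family with a single parameter.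
\<close>

lemma AC0_iff:
  "h \<in> AC0 k \<longleftrightarrow>
     (\<exists>c. \<forall>n. \<exists>f. computes n k ((n + 2) ^ c) f \<and> (\<forall>x \<in> cube {..<n}. f x = h n x))"
proof
  assume "h \<in> AC0 k"
  then obtain C and p :: "nat poly" where C: "\<And>n. wf_circuit n (C n) \<and> circuit_depth (C n) \<le> k \<and>
      circuit_size (C n) \<le> poly p n \<and> (\<forall>x \<in> cube {..<n}. circuit_eval (C n) x = h n x)"
    unfolding AC0_def by blast
  obtain c where c: "\<And>n. poly p n \<le> (n + 2) ^ c" using nat_poly_bound by blast
  have "computes n k ((n + 2) ^ c) (circuit_eval (C n))" for n
    using computes_mono[OF computes_circuit_eval order_refl order_refl, of n "C n" k]
      C[of n] c[of n] by auto
  then show "\<exists>c. \<forall>n. \<exists>f. computes n k ((n + 2) ^ c) f \<and> (\<forall>x \<in> cube {..<n}. f x = h n x)"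
    using C by blast
next
  assume "\<exists>c. \<forall>n. \<exists>f. computes n k ((n + 2) ^ c) f \<and> (\<forall>x \<in> cube {..<n}. f x = h n x)"
  then obtain c f where f: "\<And>n. computes n k ((n + 2) ^ c) (f n)"
    "\<And>n. \<forall>x \<in> cube {..<n}. f n x = h n x" by metis
  have "\<exists>C. wf_circuit n C \<and> circuit_depth C \<le> k \<and>
      circuit_size C \<le> (n + 2) ^ c \<and> (\<forall>x \<in> cube {..<n}. circuit_eval C x = h n x)" for n
    using computes_imp_circuit[OF f(1)] f(2) by metis
  then obtain C where "\<And>n. wf_circuit n (C n) \<and> circuit_depth (C n) \<le> k \<and>
      circuit_size (C n) \<le> (n + 2) ^ c \<and> (\<forall>x \<in> cube {..<n}. circuit_eval (C n) x = h n x)"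
    by metis
  moreover have "poly ([:2, 1:] ^ c) n = (n + 2) ^ c" for n :: nat
    by (simp add: poly_power add.commute)
  ultimately show "h \<in> AC0 k"
    unfolding AC0_def by (intro CollectI exI[of _ C] exI[of _ "[:2, 1:] ^ c"]) simp
qed

section \<open>Polynomials over the field with three elements\<close>

lemma three_cases: "(a :: 3) = 0 \<or> a = 1 \<or> a = - 1"
proof -
  have "(3 :: 3) = 0" "(2 :: 3) = - 1" by simp_all
  then show ?thesis using exhaust_3[of a] by metis
qed

lemma three_square: "(a :: 3) * a = of_bool (a \<noteq> 0)"
  using three_cases[of a] by auto

text \<open>
  Inputs are represented by the set \<open>X\<close> of the variables that are true. The character \<open>chi T\<close> is the
  monomial \<open>\<Prod>i\<in>T. y\<^sub>i\<close> in the variables \<open>y\<^sub>i = - 1\<close> (if \<open>i \<in> X\<close>) and \<open>y\<^sub>i = 1\<close> (otherwise). In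
  these variables parity, with the values \<open>1\<close> (even) and \<open>- 1\<close> (odd), is the monomial of all
  variables, and \<open>y\<^sub>i\<^sup>2 = 1\<close>.
\<close>

definition chi :: "nat set \<Rightarrow> nat set \<Rightarrow> 3" where
  "chi T X = (- 1) ^ card (T \<inter> X)"

lemma chi_empty: "chi {} X = 1"
  unfolding chi_def by simp

lemma chi_mult:
  assumes "finite T" "finite U"
  shows "chi T X * chi U X = chi (sym_diff T U) X"
proof -
  define A where "A = (T - U) \<inter> X"
  define B where "B = (U - T) \<inter> X"
  define C where "C = T \<inter> U \<inter> X"
  have f: "finite A" "finite B" "finite C" using assms unfolding A_def B_def C_def by auto
  have "T \<inter> X = A \<union> C" "U \<inter> X = B \<union> C" "sym_diff T U \<inter> X = A \<union> B"
    unfolding A_def B_def C_def by auto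
  moreover have "A \<inter> C = {}" "B \<inter> C = {}" "A \<inter> B = {}" unfolding A_def B_def C_def by auto
  ultimately have "card (T \<inter> X) = card A + card C" "card (U \<inter> X) = card B + card C"
    "card (sym_diff T U \<inter> X) = card A + card B"
    using f by (simp_all add: card_Un_disjoint)
  moreover have "(- 1 :: 3) ^ c * (- 1) ^ c = 1" for c
    by (simp flip: power_mult_distrib)
  ultimately show ?thesis unfolding chi_def by (simp add: power_add algebra_simps)
qed

text \<open>
  Since \<open>y\<^sub>i\<^sup>2 = 1\<close>, every monomial reduces to a character. The span of the characters of degree at
  most \<open>k\<close> therefore comprises all polynomials of degree at most \<open>k\<close> in \<open>m\<close> variables.
\<close>

inductive_set lowdeg :: "nat \<Rightarrow> nat \<Rightarrow> (nat set \<Rightarrow> 3) set" for m k where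
  chi: "T \<subseteq> {..<m} \<Longrightarrow> card T \<le> k \<Longrightarrow> chi T \<in> lowdeg m k"
| add: "P \<in> lowdeg m k \<Longrightarrow> Q \<in> lowdeg m k \<Longrightarrow> (\<lambda>X. P X + Q X) \<in> lowdeg m k"
| scale: "P \<in> lowdeg m k \<Longrightarrow> (\<lambda>X. c * P X) \<in> lowdeg m k"

lemma lowdeg_const: "(\<lambda>X. c) \<in> lowdeg m k"
  using lowdeg.scale[OF lowdeg.chi[of "{}" m k], of c] by (simp add: chi_empty)

lemma lowdeg_mono:
  assumes "P \<in> lowdeg m k" "k \<le> k'"
  shows "P \<in> lowdeg m k'"
  using assms(1) by induction (use assms(2) in \<open>auto intro: lowdeg.intros\<close>)

lemma lowdeg_sum:
  assumes "finite I" "\<And>i. i \<in> I \<Longrightarrow> P i \<in> lowdeg m k"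
  shows "(\<lambda>X. \<Sum>i\<in>I. P i X) \<in> lowdeg m k"
  using assms by (induction I rule: finite_induct) (auto intro: lowdeg.add lowdeg_const)

lemma lowdeg_diff_one: "P \<in> lowdeg m k \<Longrightarrow> (\<lambda>X. 1 - P X) \<in> lowdeg m k"
  using lowdeg.add[OF lowdeg_const lowdeg.scale, of P m k 1 "- 1"] by simp

lemma lowdeg_mult:
  assumes "P \<in> lowdeg m k" "Q \<in> lowdeg m l"
  shows "(\<lambda>X. P X * Q X) \<in> lowdeg m (k + l)"
  using assms(1)
proof induction
  case (chi T)
  have T: "finite T" using chi finite_subset by blast
  show ?case using assms(2)
  proof induction
    case U: (chi U)
    have "finite U" using U finite_subset by blast
    then have "(\<lambda>X. chi T X * chi U X) = chi (sym_diff T U)"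
      using T by (simp add: chi_mult fun_eq_iff)
    moreover have "card (sym_diff T U) \<le> k + l"
    proof -
      have "card (sym_diff T U) \<le> card (T - U) + card (U - T)" by (rule card_Un_le)
      also have "\<dots> \<le> card T + card U"
        using T \<open>finite U\<close> by (intro add_mono card_mono) auto
      finally show ?thesis using chi U by linarith
    qed
    ultimately show ?case using chi U lowdeg.chi[of "sym_diff T U" m "k + l"] by auto
  next
    case (add P Q)
    then show ?case using lowdeg.add by (fastforce simp: algebra_simps)
  next
    case (scale P c)
    then show ?case using lowdeg.scale[of "\<lambda>X. chi T X * P X" m "k + l" c]
      by (simp add: algebra_simps)
  qed
next
  case (add P P')
  then show ?case
    using lowdeg.add[of "\<lambda>X. P X * Q X" m "k + l" "\<lambda>X. P' X * Q X"] by (simp add: algebra_simps)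
next
  case (scale P c)
  then show ?case using lowdeg.scale[of "\<lambda>X. P X * Q X" m "k + l" c]
    by (simp add: algebra_simps)
qed

lemma lowdeg_prod:
  assumes "finite I" "\<And>i. i \<in> I \<Longrightarrow> P i \<in> lowdeg m k"
  shows "(\<lambda>X. \<Prod>i\<in>I. P i X) \<in> lowdeg m (card I * k)"
  using assms
  by (induction I rule: finite_induct) (auto intro: lowdeg_mult lowdeg_const)

lemma chi_singleton: "chi {i} X = (if i \<in> X then - 1 else 1)"
  unfolding chi_def by auto

lemma of_bool_mem_lowdeg: "i < m \<Longrightarrow> 1 \<le> k \<Longrightarrow> (\<lambda>X. of_bool (i \<in> X)) \<in> lowdeg m k"
proof -
  assume "i < m" "1 \<le> k"
  then have "(\<lambda>X. - 1 + chi {i} X) \<in> lowdeg m k"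
    by (intro lowdeg.add lowdeg_const lowdeg.chi) auto
  moreover have "- 1 + chi {i} X = of_bool (i \<in> X)" for X
    by (simp add: chi_singleton)
  ultimately show ?thesis by simp
qed

text \<open>
  Interpolation: the indicator of a point is a product of \<open>m\<close> polynomials of degree one.
\<close>

lemma lowdeg_all:
  fixes f :: "nat set \<Rightarrow> 3"
  shows "\<exists>P\<in>lowdeg m m. \<forall>X\<subseteq>{..<m}. P X = f X"
proof -
  define ind where "ind Y X = (\<Prod>i<m. if i \<in> Y then of_bool (i \<in> X) else 1 - of_bool (i \<in> X) :: 3)"
    for Y X
  have "ind Y \<in> lowdeg m (card {..<m} * 1)" for Y
    unfolding ind_def
  proof (rule lowdeg_prod)
    show "(\<lambda>X. if i \<in> Y then of_bool (i \<in> X) else 1 - of_bool (i \<in> X)) \<in> lowdeg m 1"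
      if "i \<in> {..<m}" for i
      using that of_bool_mem_lowdeg[of i m 1] lowdeg_diff_one[of "\<lambda>X. of_bool (i \<in> X)" m 1]
      by (cases "i \<in> Y") simp_all
  qed simp
  then have "(\<lambda>X. \<Sum>Y\<in>Pow {..<m}. f Y * ind Y X) \<in> lowdeg m m"
    by (intro lowdeg_sum lowdeg.scale) auto
  moreover have "(\<Sum>Y\<in>Pow {..<m}. f Y * ind Y X) = f X" if X: "X \<subseteq> {..<m}" for X
  proof -
    have "ind Y X = of_bool (Y = X)" if Y: "Y \<subseteq> {..<m}" for Y
    proof (cases "Y = X")
      case True
      then show ?thesis unfolding ind_def by (auto intro!: prod.neutral)
    next
      case False
      then obtain i where "i < m" "i \<in> Y \<longleftrightarrow> i \<notin> X" using X Y by blast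
      then show ?thesis unfolding ind_def using False by (auto intro!: prod_zero bexI[of _ i])
    qed
    then have "(\<Sum>Y\<in>Pow {..<m}. f Y * ind Y X) = (\<Sum>Y\<in>Pow {..<m}. if Y = X then f Y else 0)"
      by (intro sum.cong) auto
    then show ?thesis using X by (simp add: sum.delta)
  qed
  ultimately show ?thesis
    by (intro bexI[of _ "\<lambda>X. \<Sum>Y\<in>Pow {..<m}. f Y * ind Y X"] allI impI)
qed

lemma lowdeg_coeffs:
  assumes "P \<in> lowdeg m k"
  shows "\<exists>c. P = (\<lambda>X. \<Sum>T | T \<subseteq> {..<m} \<and> card T \<le> k. c T * chi T X)"
  using assms
proof induction
  case (chi T)
  have fin: "finite {T. T \<subseteq> {..<m} \<and> card T \<le> k}" by simp
  have "(\<Sum>U | U \<subseteq> {..<m} \<and> card U \<le> k. of_bool (U = T) * chi U X) = chi T X" for X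
  proof -
    have "(\<Sum>U | U \<subseteq> {..<m} \<and> card U \<le> k. of_bool (U = T) * chi U X) =
        (\<Sum>U | U \<subseteq> {..<m} \<and> card U \<le> k. if U = T then chi U X else 0)"
      by (intro sum.cong) auto
    then show ?thesis using chi fin by (simp add: sum.delta)
  qed
  then show ?case by (intro exI[of _ "\<lambda>U. of_bool (U = T)"]) simp
next
  case (add P Q)
  then obtain c d where "P = (\<lambda>X. \<Sum>T | T \<subseteq> {..<m} \<and> card T \<le> k. c T * chi T X)"
    "Q = (\<lambda>X. \<Sum>T | T \<subseteq> {..<m} \<and> card T \<le> k. d T * chi T X)" by blast
  then show ?case
    by (intro exI[of _ "\<lambda>T. c T + d T"]) (simp add: sum.distrib algebra_simps)
next
  case (scale P a)
  then obtain c where "P = (\<lambda>X. \<Sum>T | T \<subseteq> {..<m} \<and> card T \<le> k. c T * chi T X)" by blast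
  then show ?case
    by (intro exI[of _ "\<lambda>T. a * c T"]) (simp add: sum_distrib_left algebra_simps)
qed

text \<open>
  Smolensky's counting argument. If \<open>T\<close> has more than \<open>m div 2\<close> elements, then \<open>chi T\<close> is parity
  times the character of the complement of \<open>T\<close>; on \<open>G\<close> parity may be replaced by \<open>P\<close>. So on \<open>G\<close> every
  function has degree at most \<open>m div 2 + k\<close>, and counting functions on \<open>G\<close> against coefficient
  vectors bounds the size of \<open>G\<close>.
\<close>

lemma card_agree_parity_le:
  assumes G: "G \<subseteq> Pow {..<m}" and P: "P \<in> lowdeg m k" "\<And>X. X \<in> G \<Longrightarrow> P X = chi {..<m} X"
  shows "card G \<le> card {T. T \<subseteq> {..<m} \<and> card T \<le> m div 2 + k}"
proof -
  define S where "S = {T. T \<subseteq> {..<m} \<and> card T \<le> m div 2 + k}"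
  have finS: "finite S" unfolding S_def by simp
  have finG: "finite G" using G finite_subset by blast
  have reduce: "\<exists>R\<in>lowdeg m (m div 2 + k). \<forall>X\<in>G. R X = Q X" if "Q \<in> lowdeg m m" for Q
    using that
  proof induction
    case (chi T)
    show ?case
    proof (cases "card T \<le> m div 2 + k")
      case True
      then show ?thesis using chi by (intro bexI[of _ "chi T"] lowdeg.chi) auto
    next
      case False
      have T: "finite T" using chi finite_subset by blast
      have "card ({..<m} - T) = m - card T" using chi by (simp add: card_Diff_subset T)
      then have "chi ({..<m} - T) \<in> lowdeg m (m div 2)"
        using False by (intro lowdeg.chi) auto
      then have "(\<lambda>X. chi ({..<m} - T) X * P X) \<in> lowdeg m (m div 2 + k)"
        using P(1) by (rule lowdeg_mult)
      moreover have "chi ({..<m} - T) X * P X = chi T X" if "X \<in> G" for X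
      proof -
        have "sym_diff ({..<m} - T) {..<m} = T" using chi by auto
        then show ?thesis using chi_mult[of "{..<m} - T" "{..<m}" X] P(2)[OF that] T by simp
      qed
      ultimately show ?thesis
        by (intro bexI[of _ "\<lambda>X. chi ({..<m} - T) X * P X"] ballI)
    qed
  next
    case (add Q Q')
    then obtain R R' where R: "R \<in> lowdeg m (m div 2 + k)" "\<forall>X\<in>G. R X = Q X"
      "R' \<in> lowdeg m (m div 2 + k)" "\<forall>X\<in>G. R' X = Q' X" by blast
    then show ?case by (intro bexI[OF _ lowdeg.add[OF R(1,3)]]) auto
  next
    case (scale Q c)
    then obtain R where R: "R \<in> lowdeg m (m div 2 + k)" "\<forall>X\<in>G. R X = Q X" by blast
    then show ?case by (intro bexI[OF _ lowdeg.scale[OF R(1), of c]]) auto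
  qed
  define ev where "ev c = restrict (\<lambda>X. \<Sum>T\<in>S. c T * chi T X) G" for c :: "nat set \<Rightarrow> 3"
  have "(G \<rightarrow>\<^sub>E (UNIV :: 3 set)) \<subseteq> ev ` (S \<rightarrow>\<^sub>E UNIV)"
  proof
    fix f :: "nat set \<Rightarrow> 3" assume f: "f \<in> G \<rightarrow>\<^sub>E UNIV"
    obtain Q where Q: "Q \<in> lowdeg m m" "\<forall>X\<subseteq>{..<m}. Q X = f X" using lowdeg_all by blast
    obtain R where R: "R \<in> lowdeg m (m div 2 + k)" "\<forall>X\<in>G. R X = Q X" using reduce[OF Q(1)] by blast
    obtain c where c: "R = (\<lambda>X. \<Sum>T\<in>S. c T * chi T X)"
      using lowdeg_coeffs[OF R(1)] unfolding S_def by blast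
    have "R = (\<lambda>X. \<Sum>T\<in>S. restrict c S T * chi T X)"
      unfolding c by (intro ext sum.cong) auto
    then have "ev (restrict c S) = restrict R G" unfolding ev_def by (simp only:)
    also have "\<dots> = f"
    proof
      fix X show "restrict R G X = f X"
        using R(2) Q(2) G PiE_arb[OF f, of X] by (cases "X \<in> G") auto
    qed
    finally have "f = ev (restrict c S)" ..
    moreover have "restrict c S \<in> S \<rightarrow>\<^sub>E UNIV" by simp
    ultimately show "f \<in> ev ` (S \<rightarrow>\<^sub>E UNIV)" by (rule image_eqI)
  qed
  then have "card (G \<rightarrow>\<^sub>E (UNIV :: 3 set)) \<le> card (ev ` (S \<rightarrow>\<^sub>E UNIV))"
    using finS by (intro card_mono finite_imageI finite_PiE) auto
  also have "\<dots> \<le> card (S \<rightarrow>\<^sub>E (UNIV :: 3 set))"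
    using finS by (intro card_image_le finite_PiE) auto
  finally have "(3 :: nat) ^ card G \<le> 3 ^ card S"
    using finG finS by (simp add: card_funcsetE)
  then have "card G \<le> card S" by simp
  then show ?thesis unfolding S_def .
qed

text \<open>
  Squaring turns the bound \<open>4 ^ r / sqrt (2 * r + 1)\<close> into one that an induction on natural numbers
  can carry.
\<close>

lemma central_binomial_upper: "((2 * r) choose r)\<^sup>2 * (2 * r + 1) \<le> 16 ^ r"
proof (induction r)
  case 0
  then show ?case by simp
next
  case (Suc r)
  define b c where "b = (2 * r) choose r" and "c = (2 * Suc r) choose Suc r"
  have rec: "c * (r + 1) = 2 * (2 * r + 1) * b"
  proof -
    have 1: "Suc r * c = (2 * r + 2) * ((2 * r + 1) choose r)"
      unfolding c_def using Suc_times_binomial_eq[of "2 * r + 1" r] by (simp add: mult.commute)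
    have "(2 * r + 1) choose r = (2 * r + 1) choose Suc r"
      using binomial_symmetric[of r "2 * r + 1"] by simp
    moreover have "Suc r * ((2 * r + 1) choose Suc r) = (2 * r + 1) * b"
      unfolding b_def using Suc_times_binomial_eq[of "2 * r" r] by (simp add: mult.commute)
    ultimately have 2: "Suc r * ((2 * r + 1) choose r) = (2 * r + 1) * b" by simp
    have "Suc r * c = 2 * (Suc r * ((2 * r + 1) choose r))" unfolding 1 by simp
    also have "\<dots> = 2 * ((2 * r + 1) * b)" unfolding 2 ..
    finally show ?thesis by (simp add: algebra_simps)
  qed
  have square: "(2 * x * y)\<^sup>2 * z = 4 * (x * z) * (y\<^sup>2 * x)" for x y z :: nat
    by (simp add: power2_eq_square)
  have "(c\<^sup>2 * (2 * Suc r + 1)) * (r + 1)\<^sup>2 = (c * (r + 1))\<^sup>2 * (2 * r + 3)"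
    by (simp add: power2_eq_square algebra_simps)
  also have "\<dots> = 4 * ((2 * r + 1) * (2 * r + 3)) * (b\<^sup>2 * (2 * r + 1))"
    unfolding rec by (rule square)
  also have "\<dots> \<le> 4 * ((2 * r + 1) * (2 * r + 3)) * 16 ^ r"
    using Suc unfolding b_def by (intro mult_le_mono2)
  also have "\<dots> \<le> 16 * (r + 1)\<^sup>2 * 16 ^ r"
    by (intro mult_le_mono1) (simp add: power2_eq_square algebra_simps)
  finally have "(c\<^sup>2 * (2 * Suc r + 1)) * (r + 1)\<^sup>2 \<le> 16 ^ Suc r * (r + 1)\<^sup>2"
    by (simp add: algebra_simps)
  then show ?case unfolding c_def by simp
qed

text \<open>
  Complementation shows that the sets with fewer than \<open>r\<close> elements are at most half of all sets; each
  of the other \<open>k + 1\<close> sizes contributes at most the central binomial coefficient.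
\<close>

lemma card_small_sets:
  "card {T. T \<subseteq> {..<2 * r} \<and> card T \<le> r + k} \<le> 4 ^ r div 2 + (k + 1) * ((2 * r) choose r)"
proof -
  define N where "N j = card {T. T \<subseteq> {..<2 * r} \<and> card T = j}" for j
  have N: "N j = (2 * r) choose j" for j
    unfolding N_def using n_subsets[of "{..<2 * r}" j] by simp
  have below: "2 * card {T. T \<subseteq> {..<2 * r} \<and> card T < r} \<le> 4 ^ r"
  proof -
    let ?A = "{T. T \<subseteq> {..<2 * r} \<and> card T < r}"
    let ?c = "\<lambda>T. {..<2 * r} - T"
    have "inj_on ?c ?A" by (rule inj_onI) blast
    then have "card (?c ` ?A) = card ?A" by (rule card_image)
    moreover have "?A \<inter> ?c ` ?A = {}"
      by (auto simp: card_Diff_subset finite_subset[OF _ finite_lessThan])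
    moreover have "finite ?A" by simp
    ultimately have "2 * card ?A = card (?A \<union> ?c ` ?A)"
      by (simp add: card_Un_disjoint)
    also have "\<dots> \<le> card (Pow {..<2 * r})" by (intro card_mono) auto
    finally show ?thesis by (simp add: card_Pow power_mult)
  qed
  have "{T. T \<subseteq> {..<2 * r} \<and> card T \<le> r + k} \<subseteq> {T. T \<subseteq> {..<2 * r} \<and> card T < r} \<union>
      (\<Union>j\<in>{r..r + k}. {T. T \<subseteq> {..<2 * r} \<and> card T = j})" by auto
  then have "card {T. T \<subseteq> {..<2 * r} \<and> card T \<le> r + k} \<le> card ({T. T \<subseteq> {..<2 * r} \<and> card T < r} \<union>
      (\<Union>j\<in>{r..r + k}. {T. T \<subseteq> {..<2 * r} \<and> card T = j}))"
    by (rule card_mono[rotated]) auto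
  also have "\<dots> \<le> card {T. T \<subseteq> {..<2 * r} \<and> card T < r} + (\<Sum>j\<in>{r..r + k}. N j)"
    unfolding N_def by (rule order_trans[OF card_Un_le add_left_mono[OF card_UN_le]]) simp
  also have "(\<Sum>j\<in>{r..r + k}. N j) \<le> (\<Sum>j\<in>{r..r + k}. (2 * r) choose r)"
    unfolding N by (intro sum_mono) (rule binomial_maximum')
  finally show ?thesis using below by simp
qed

section \<open>Approximating a gate by a polynomial of low degree\<close>

text \<open>
  If \<open>v i x \<noteq> 0\<close>, then adding \<open>i\<close> to or removing it from \<open>S\<close> changes the sum over \<open>S\<close>, so for each \<open>x\<close>
  at most half of the subsets give \<open>0\<close>. By averaging, some subset does so for at most half of the
  \<open>x\<close>.
\<close>

lemma exists_good_subset: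
  fixes v :: "'i \<Rightarrow> 'x \<Rightarrow> 3"
  assumes "finite I" "finite A" "\<And>x. x \<in> A \<Longrightarrow> \<exists>i\<in>I. v i x \<noteq> 0"
  shows "\<exists>S\<subseteq>I. 2 * card {x \<in> A. (\<Sum>i\<in>S. v i x) = 0} \<le> card A"
proof -
  define Z where "Z S = {x \<in> A. (\<Sum>i\<in>S. v i x) = 0}" for S
  have half: "2 * card {S \<in> Pow I. (\<Sum>i\<in>S. v i x) = 0} \<le> 2 ^ card I" if x: "x \<in> A" for x
  proof -
    obtain i where i: "i \<in> I" "v i x \<noteq> 0" using assms(3) x by blast
    define z where "z = {S \<in> Pow I. (\<Sum>i\<in>S. v i x) = 0}"
    define t where "t S = sym_diff S {i}" for S
    have "inj_on t z" unfolding t_def by (rule inj_onI) blast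
    then have c: "card (t ` z) = card z" by (rule card_image)
    have nz: "(\<Sum>j\<in>t S. v j x) \<noteq> 0" if S: "S \<in> z" for S
    proof -
      have S0: "finite S" "(\<Sum>j\<in>S. v j x) = 0"
        using S assms(1) finite_subset unfolding z_def by auto
      show ?thesis
      proof (cases "i \<in> S")
        case True
        then have "(\<Sum>j\<in>S. v j x) = v i x + (\<Sum>j\<in>S - {i}. v j x)"
          using S0(1) by (intro sum.remove)
        then have "(\<Sum>j\<in>S - {i}. v j x) \<noteq> 0" using S0(2) i(2) by auto
        moreover have "t S = S - {i}" using True unfolding t_def by auto
        ultimately show ?thesis by simp
      next
        case False
        then have "(\<Sum>j\<in>insert i S. v j x) = v i x + (\<Sum>j\<in>S. v j x)"
          using S0(1) by (intro sum.insert)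
        then have "(\<Sum>j\<in>insert i S. v j x) \<noteq> 0" using S0(2) i(2) by auto
        moreover have "t S = insert i S" using False unfolding t_def by auto
        ultimately show ?thesis by simp
      qed
    qed
    have "z \<inter> t ` z = {}"
    proof (rule equals0I)
      fix U assume U: "U \<in> z \<inter> t ` z"
      then obtain S where S: "S \<in> z" "U = t S" by blast
      have "(\<Sum>j\<in>U. v j x) = 0" using U unfolding z_def by simp
      then show False using nz[OF S(1)] S(2) by simp
    qed
    moreover have "finite z" unfolding z_def using assms(1) by simp
    ultimately have "2 * card z = card (z \<union> t ` z)"
      using c by (simp add: card_Un_disjoint)
    also have "\<dots> \<le> card (Pow I)"
      using i(1) assms(1) unfolding z_def t_def by (intro card_mono) auto
    finally show ?thesis using assms(1) unfolding z_def by (simp add: card_Pow)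
  qed
  have "(\<Sum>S\<in>Pow I. card (Z S)) = (\<Sum>S\<in>Pow I. \<Sum>x\<in>A. of_bool ((\<Sum>i\<in>S. v i x) = 0))"
    unfolding Z_def using assms(2) by (intro sum.cong) (auto simp: Int_def)
  also have "\<dots> = (\<Sum>x\<in>A. \<Sum>S\<in>Pow I. of_bool ((\<Sum>i\<in>S. v i x) = 0))"
    by (rule sum.swap)
  also have "\<dots> = (\<Sum>x\<in>A. card {S \<in> Pow I. (\<Sum>i\<in>S. v i x) = 0})"
    using assms(1) by (intro sum.cong) (auto simp: Int_def)
  finally have "2 * (\<Sum>S\<in>Pow I. card (Z S)) = (\<Sum>x\<in>A. 2 * card {S \<in> Pow I. (\<Sum>i\<in>S. v i x) = 0})"
    by (simp add: sum_distrib_left)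
  also have "\<dots> \<le> (\<Sum>x\<in>A. 2 ^ card I)" using half by (intro sum_mono)
  finally have le: "2 * (\<Sum>S\<in>Pow I. card (Z S)) \<le> card A * 2 ^ card I" by simp
  show ?thesis
  proof (rule ccontr)
    assume "\<not> ?thesis"
    then have "card A < 2 * card (Z S)" if "S \<in> Pow I" for S
      using that unfolding Z_def by (meson PowD not_le)
    then have "(\<Sum>S\<in>Pow I. card A) < (\<Sum>S\<in>Pow I. 2 * card (Z S))"
      using assms(1) by (intro sum_strict_mono) auto
    then show False using le assms(1) by (simp add: card_Pow sum_distrib_left mult.commute)
  qed
qed

text \<open>
  \<open>Q\<close> is a product of \<open>l\<close> factors \<open>1 - L\<^sup>2\<close>, where each \<open>L\<close> is the sum of the \<open>P i\<close> over a good subset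
  of the indices. The factor is \<open>1\<close> where all \<open>P i\<close> vanish, and it kills at least half of the points of
  \<open>A\<close> that the previous factors have left.
\<close>

lemma or_approx:
  assumes "finite I" "\<And>i. i \<in> I \<Longrightarrow> P i \<in> lowdeg m k" "finite A"
    "\<And>X. X \<in> A \<Longrightarrow> \<exists>i\<in>I. P i X \<noteq> 0"
  shows "\<exists>Q\<in>lowdeg m (2 * l * k). (\<forall>X. (\<forall>i\<in>I. P i X = 0) \<longrightarrow> Q X = 1) \<and>
    2 ^ l * card {X \<in> A. Q X \<noteq> 0} \<le> card A"
proof (induction l)
  case 0
  then show ?case
    using card_mono[OF assms(3), of "{X \<in> A. (1 :: 3) \<noteq> 0}"]
    by (intro bexI[of _ "\<lambda>X. 1"] lowdeg_const) auto
next
  case (Suc l)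
  then obtain Q where Q: "Q \<in> lowdeg m (2 * l * k)" "\<forall>X. (\<forall>i\<in>I. P i X = 0) \<longrightarrow> Q X = 1"
    "2 ^ l * card {X \<in> A. Q X \<noteq> 0} \<le> card A" by blast
  let ?B = "{X \<in> A. Q X \<noteq> 0}"
  obtain S where S: "S \<subseteq> I" "2 * card {X \<in> ?B. (\<Sum>i\<in>S. P i X) = 0} \<le> card ?B"
    using exists_good_subset[OF assms(1), of ?B P] assms(3,4) by auto
  define L where "L X = (\<Sum>i\<in>S. P i X)" for X
  have L: "L \<in> lowdeg m k"
    unfolding L_def using assms(1,2) S(1) finite_subset by (intro lowdeg_sum) auto
  define R where "R X = Q X * (1 - L X * L X)" for X
  have R: "R X = (if L X = 0 then Q X else 0)" for X
    unfolding R_def by (simp add: three_square)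
  have "R \<in> lowdeg m (2 * l * k + (k + k))"
    unfolding R_def by (intro lowdeg_mult Q(1) lowdeg_diff_one L)
  moreover have "2 * l * k + (k + k) = 2 * Suc l * k" by simp
  moreover have "R X = 1" if "\<forall>i\<in>I. P i X = 0" for X
  proof -
    have "L X = 0" unfolding L_def using that S(1) by (intro sum.neutral) auto
    then show ?thesis using Q(2) that R by simp
  qed
  moreover have "{X \<in> A. R X \<noteq> 0} = {X \<in> ?B. (\<Sum>i\<in>S. P i X) = 0}"
    unfolding R L_def by auto
  then have "2 ^ Suc l * card {X \<in> A. R X \<noteq> 0} \<le> 2 ^ l * card ?B"
    using S(2) by (simp add: mult.assoc)
  then have "2 ^ Suc l * card {X \<in> A. R X \<noteq> 0} \<le> card A" using Q(3) by linarith
  ultimately show ?case by (intro bexI[of _ R]) auto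
qed

section \<open>Parity needs large circuits of bounded depth\<close>

lemma or_gate_approx:
  assumes I: "finite I" "\<And>i. i \<in> I \<Longrightarrow> P i \<in> lowdeg m k"
    and G: "G \<subseteq> Pow {..<m}" "\<And>i X. i \<in> I \<Longrightarrow> X \<in> G \<Longrightarrow> P i X = of_bool (u i X)"
  shows "\<exists>Q\<in>lowdeg m (2 * l * k). \<exists>E\<subseteq>Pow {..<m}. 2 ^ l * card E \<le> 2 ^ m \<and>
    (\<forall>X\<in>G - E. Q X = of_bool (\<exists>i\<in>I. u i X))"
proof -
  define A where "A = {X \<in> G. \<exists>i\<in>I. u i X}"
  have A: "A \<subseteq> Pow {..<m}" using G(1) unfolding A_def by blast
  then have finA: "finite A" by (rule finite_subset) simp
  have nz: "\<exists>i\<in>I. P i X \<noteq> 0" if "X \<in> A" for X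
  proof -
    obtain i where i: "i \<in> I" "u i X" "X \<in> G" using \<open>X \<in> A\<close> unfolding A_def by blast
    then have "P i X = 1" using G(2)[of i X] by simp
    then show ?thesis using i(1) by (intro bexI[of _ i]) auto
  qed
  obtain Q where Q: "Q \<in> lowdeg m (2 * l * k)" "\<forall>X. (\<forall>i\<in>I. P i X = 0) \<longrightarrow> Q X = 1"
    "2 ^ l * card {X \<in> A. Q X \<noteq> 0} \<le> card A"
    using or_approx[of I P m k A l, OF I finA nz] by blast
  define E where "E = {X \<in> A. Q X \<noteq> 0}"
  have "card A \<le> 2 ^ m" using card_mono[OF _ A] by (simp add: card_Pow)
  then have "2 ^ l * card E \<le> 2 ^ m" using Q(3) unfolding E_def by linarith
  moreover have "E \<subseteq> Pow {..<m}" using A unfolding E_def by blast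
  moreover have "1 - Q X = of_bool (\<exists>i\<in>I. u i X)" if X: "X \<in> G - E" for X
  proof (cases "X \<in> A")
    case True
    then have "Q X = 0" using X unfolding E_def by blast
    then show ?thesis using True unfolding A_def by simp
  next
    case False
    then have no: "\<not> u i X" if "i \<in> I" for i using that X unfolding A_def by blast
    then have "\<forall>i\<in>I. P i X = 0" using G(2)[of _ X] X by simp
    then have "Q X = 1" using Q(2) by blast
    then show ?thesis using no by auto
  qed
  moreover have "(\<lambda>X. 1 - Q X) \<in> lowdeg m (2 * l * k)" using Q(1) by (rule lowdeg_diff_one)
  ultimately show ?thesis
    by (intro bexI[of _ "\<lambda>X. 1 - Q X"] exI[of _ E] conjI ballI)
qed

text \<open>
  \<open>B\<close> is a set of bad inputs, common to all gates of a circuit. On it nothing is required.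
\<close>

definition approximates ::
  "nat \<Rightarrow> nat \<Rightarrow> nat set set \<Rightarrow> ((nat \<Rightarrow> bool) \<Rightarrow> bool) \<Rightarrow> (nat set \<Rightarrow> 3) \<Rightarrow> bool" where
  "approximates m k B f P \<longleftrightarrow>
     P \<in> lowdeg m k \<and> (\<forall>X\<in>Pow {..<m} - B. P X = of_bool (f (\<lambda>i. i \<in> X)))"

lemma approximates_mono:
  "approximates m k B f P \<Longrightarrow> k \<le> k' \<Longrightarrow> B \<subseteq> B' \<Longrightarrow> approximates m k' B' f P"
  unfolding approximates_def using lowdeg_mono by blast

lemma approximates_lit:
  assumes "f \<in> lits n" "1 \<le> k"
  shows "\<exists>P. approximates m k B f P"
proof -
  have pos: "\<exists>P\<in>lowdeg m k. \<forall>X\<in>Pow {..<m}. P X = of_bool (i \<in> X)" for i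
  proof (cases "i < m")
    case True
    then show ?thesis
      using assms(2) by (intro bexI[of _ "\<lambda>X. of_bool (i \<in> X)"] of_bool_mem_lowdeg) auto
  next
    case False
    then show ?thesis by (intro bexI[of _ "\<lambda>X. 0"] lowdeg_const) auto
  qed
  from assms(1) consider b where "f = (\<lambda>x. b)" | i where "f = (\<lambda>x. x i)"
    | i where "f = (\<lambda>x. \<not> x i)" unfolding lits_iff by blast
  then show ?thesis
  proof cases
    case (1 b)
    have "approximates m k B f (\<lambda>X. of_bool b)"
      unfolding approximates_def 1 using lowdeg_const by auto
    then show ?thesis by blast
  next
    case (2 i)
    obtain P where "P \<in> lowdeg m k" "\<forall>X\<in>Pow {..<m}. P X = of_bool (i \<in> X)" using pos by blast
    then have "approximates m k B f P" unfolding approximates_def 2 by simp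
    then show ?thesis by blast
  next
    case (3 i)
    obtain P where P: "P \<in> lowdeg m k" "\<forall>X\<in>Pow {..<m}. P X = of_bool (i \<in> X)" using pos by blast
    have "approximates m k B f (\<lambda>X. 1 - P X)"
      unfolding approximates_def 3 using lowdeg_diff_one[OF P(1)] P(2) by simp
    then show ?thesis by blast
  qed
qed

text \<open>
  Outside \<open>B\<close> the inputs of the gate are exact, so only the local error \<open>E\<close> of this gate is added. A
  conjunction is treated as a negated disjunction of negations.
\<close>

lemma approximates_gate:
  assumes W: "finite W" "\<And>w. w \<in> W \<Longrightarrow> \<exists>P. approximates m k B w P"
    and f: "f = conj_of W \<or> f = disj_of W"
  shows "\<exists>P. \<exists>E\<subseteq>Pow {..<m}. 2 ^ l * card E \<le> 2 ^ m \<and> approximates m (2 * l * k) (B \<union> E) f P"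
proof -
  obtain P where P: "\<And>w. w \<in> W \<Longrightarrow> approximates m k B w (P w)" using W(2) by metis
  define G where "G = Pow {..<m} - B"
  have G: "G \<subseteq> Pow {..<m}" unfolding G_def by blast
  have deg: "P w \<in> lowdeg m k" if "w \<in> W" for w
    using P[OF that] unfolding approximates_def by blast
  have val: "P w X = of_bool (w (\<lambda>i. i \<in> X))" if "w \<in> W" "X \<in> G" for w X
    using P[OF that(1)] that(2) unfolding approximates_def G_def by blast
  from f show ?thesis
  proof
    assume f: "f = disj_of W"
    obtain Q E where Q: "Q \<in> lowdeg m (2 * l * k)" "E \<subseteq> Pow {..<m}" "2 ^ l * card E \<le> 2 ^ m"
      "\<forall>X\<in>G - E. Q X = of_bool (\<exists>w\<in>W. w (\<lambda>i. i \<in> X))"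
      using or_gate_approx[where u = "\<lambda>w X. w (\<lambda>i. i \<in> X)" and l = l, OF W(1) deg G val] by blast
    have "approximates m (2 * l * k) (B \<union> E) f Q"
      unfolding approximates_def f disj_of_def using Q(1,4) unfolding G_def by blast
    then show ?thesis using Q(2,3) by blast
  next
    assume f: "f = conj_of W"
    have nval: "1 - P w X = of_bool (\<not> w (\<lambda>i. i \<in> X))" if "w \<in> W" "X \<in> G" for w X
      using val[OF that] by simp
    obtain Q E where Q: "Q \<in> lowdeg m (2 * l * k)" "E \<subseteq> Pow {..<m}" "2 ^ l * card E \<le> 2 ^ m"
      "\<forall>X\<in>G - E. Q X = of_bool (\<exists>w\<in>W. \<not> w (\<lambda>i. i \<in> X))"
      using or_gate_approx[where u = "\<lambda>w X. \<not> w (\<lambda>i. i \<in> X)" and P = "\<lambda>w X. 1 - P w X" and l = l,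
        OF W(1) lowdeg_diff_one[OF deg] G nval] by blast
    have "1 - Q X = of_bool (f (\<lambda>i. i \<in> X))" if "X \<in> G - E" for X
    proof -
      have "f (\<lambda>i. i \<in> X) \<longleftrightarrow> \<not> (\<exists>w\<in>W. \<not> w (\<lambda>i. i \<in> X))" unfolding f conj_of_def by blast
      then show ?thesis using Q(4) that by simp
    qed
    then have "approximates m (2 * l * k) (B \<union> E) f (\<lambda>X. 1 - Q X)"
      unfolding approximates_def using lowdeg_diff_one[OF Q(1)] unfolding G_def by blast
    then show ?thesis using Q(2,3) by blast
  qed
qed

lemma finite_lits: "finite (lits n)"
proof -
  have "lits n \<subseteq> (\<lambda>b x. b) ` UNIV \<union> (\<lambda>i x. x i) ` {..<n} \<union> (\<lambda>i x. \<not> x i) ` {..<n}"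
    by (auto simp: lits_iff)
  then show ?thesis by (rule finite_subset) simp
qed

lemma finite_avail: "finite F \<Longrightarrow> finite (avail n F k)"
proof -
  assume "finite F"
  moreover have "avail n F k \<subseteq> lits n \<union> snd ` F" unfolding avail_def by force
  ultimately show ?thesis using finite_lits by (meson finite_UnI finite_imageI finite_subset)
qed

text \<open>
  The gates are treated in the order of their levels, each adding its local error to \<open>B\<close>; hence the
  induction removes a gate of maximal level.
\<close>

lemma layered_approx:
  assumes "layered n F" "1 \<le> l"
  shows "\<exists>B\<subseteq>Pow {..<m}. 2 ^ l * card B \<le> card F * 2 ^ m \<and>
    (\<forall>k. \<forall>f\<in>avail n F k. \<exists>P. approximates m ((2 * l) ^ k) B f P)"
  using assms(1)
proof (induction "card F" arbitrary: F)
  case 0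
  then have "F = {}" using layered_finite by auto
  then have "\<exists>P. approximates m ((2 * l) ^ k) {} f P" if "f \<in> avail n F k" for k f
    using that approximates_lit[of f n "(2 * l) ^ k"] assms(2) unfolding avail_def by auto
  then show ?case by (intro exI[of _ "{}"]) auto
next
  case (Suc c)
  have fin: "finite F" using Suc.prems by (rule layered_finite)
  have ne: "F \<noteq> {}" using Suc.hyps(2) by auto
  define e where "e = Max (fst ` F)"
  have "e \<in> fst ` F" unfolding e_def using fin ne by (intro Max_in) auto
  then obtain f where ef: "(e, f) \<in> F" by auto
  have e_max: "e' \<le> e" if "(e', f') \<in> F" for e' f'
    unfolding e_def using fin that by (intro Max_ge) force+
  define F' where "F' = F - {(e, f)}"
  have sub: "avail n F j \<subseteq> avail n F' j" if "j < e" for j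
    using that unfolding avail_def F'_def by auto
  have "layered n F'"
  proof (rule layeredI)
    show "finite F'" unfolding F'_def using fin by simp
  next
    fix e' f' assume "(e', f') \<in> F'"
    then have ef': "(e', f') \<in> F" unfolding F'_def by simp
    obtain j W where j: "j < e'" "W \<subseteq> avail n F j" "f' = conj_of W \<or> f' = disj_of W"
      using layeredE[OF Suc.prems ef'] .
    have "W \<subseteq> avail n F' j" using j(1,2) sub[of j] e_max[OF ef'] by auto
    then show "gate_over n F' e' f'" using j(1,3) by (intro gate_overI)
  qed
  moreover have "c = card F'" using Suc.hyps(2) ef unfolding F'_def by simp
  ultimately obtain B where B: "B \<subseteq> Pow {..<m}" "2 ^ l * card B \<le> card F' * 2 ^ m"
    "\<forall>k. \<forall>f\<in>avail n F' k. \<exists>P. approximates m ((2 * l) ^ k) B f P"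
    using Suc.hyps(1) by blast
  obtain j W where j: "j < e" "W \<subseteq> avail n F j" "f = conj_of W \<or> f = disj_of W"
    using layeredE[OF Suc.prems ef] .
  have "finite W" using j(2) finite_avail[OF fin] finite_subset by blast
  moreover have "\<exists>P. approximates m ((2 * l) ^ j) B w P" if "w \<in> W" for w
    using that j(1,2) sub[of j] B(3) by blast
  ultimately obtain P E where E: "E \<subseteq> Pow {..<m}" "2 ^ l * card E \<le> 2 ^ m"
    "approximates m (2 * l * (2 * l) ^ j) (B \<union> E) f P"
    using approximates_gate[of W m "(2 * l) ^ j" B f l] j(3) by blast
  have pow: "(2 * l) ^ a \<le> (2 * l) ^ b" if "a \<le> b" for a b
    using assms(2) that by (intro power_increasing) auto
  have "\<exists>P. approximates m ((2 * l) ^ k) (B \<union> E) g P" if g: "g \<in> avail n F k" for k g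
  proof (cases "g \<in> avail n F' k")
    case True
    then obtain P where "approximates m ((2 * l) ^ k) B g P" using B(3) by blast
    then have "approximates m ((2 * l) ^ k) (B \<union> E) g P" by (rule approximates_mono) auto
    then show ?thesis by blast
  next
    case False
    then have "g = f" "e \<le> k" using g unfolding avail_def F'_def by auto
    then have "2 * l * (2 * l) ^ j \<le> (2 * l) ^ k" using pow[of "Suc j" k] j(1) by simp
    then have "approximates m ((2 * l) ^ k) (B \<union> E) g P"
      using approximates_mono[OF E(3)] unfolding \<open>g = f\<close> by blast
    then show ?thesis by blast
  qed
  moreover have "2 ^ l * card (B \<union> E) \<le> card F * 2 ^ m"
  proof -
    have "2 ^ l * card (B \<union> E) \<le> 2 ^ l * card B + 2 ^ l * card E"
      using card_Un_le[of B E] by (metis add_mult_distrib2 mult_le_mono2)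
    also have "\<dots> \<le> card F' * 2 ^ m + 2 ^ m" using B(2) E(2) by linarith
    also have "\<dots> = card F * 2 ^ m" using Suc.hyps(2) \<open>c = card F'\<close> by (metis add.commute mult_Suc)
    finally show ?thesis .
  qed
  ultimately show ?case using B(1) E(1) by (intro exI[of _ "B \<union> E"]) auto
qed

definition parity :: "nat \<Rightarrow> nat \<Rightarrow> (nat \<Rightarrow> bool) \<Rightarrow> bool" where
  "parity a q x \<longleftrightarrow> odd (card {i \<in> {a..<a + q}. x i})"

text \<open>
  The upper bound on \<open>s\<close> makes at most an eighth of the inputs bad, and the lower bound on \<open>r\<close>
  limits the sum of the \<open>(2 * l) ^ k + 1\<close> middle binomial coefficients to another eighth. Together
  with the half from the sets below the middle, this does not cover all inputs.
\<close>

lemma parity_lower_bound: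
  assumes comp: "computes n k s (parity 0 (2 * r))"
    and s: "0 < s" "8 * s \<le> 2 ^ l" and r: "64 * ((2 * l) ^ k + 1)\<^sup>2 \<le> 2 * r + 1"
  shows False
proof -
  define m where "m = 2 * r"
  define K where "K = (2 * l) ^ k"
  have l: "1 \<le> l" using s by (cases l) auto
  obtain F where F: "layered n F" "card F \<le> s" "parity 0 m \<in> avail n F k"
    using comp unfolding computes_def m_def by blast
  obtain B where B: "B \<subseteq> Pow {..<m}" "2 ^ l * card B \<le> card F * 2 ^ m"
    "\<forall>k. \<forall>f\<in>avail n F k. \<exists>P. approximates m ((2 * l) ^ k) B f P"
    using layered_approx[OF F(1) l, of m] by (elim exE conjE)
  obtain P where P: "approximates m K B (parity 0 m) P"
    using B(3)[rule_format, OF F(3)] unfolding K_def by (elim exE)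
  define G where "G = Pow {..<m} - B"
  \<comment> \<open>In characteristic three, \<open>1 + 1 = - 1\<close>, so \<open>P \<mapsto> 1 + P\<close> turns the truth values into signs.\<close>
  have "1 + P X = chi {..<m} X" if X: "X \<in> G" for X
  proof -
    have "{i \<in> {0..<0 + m}. i \<in> X} = {..<m} \<inter> X" by auto
    then have "P X = of_bool (odd (card ({..<m} \<inter> X)))"
      using P X unfolding approximates_def G_def parity_def by simp
    then show ?thesis unfolding chi_def by (auto simp: minus_one_power_iff)
  qed
  moreover have "(\<lambda>X. 1 + P X) \<in> lowdeg m K"
    using P unfolding approximates_def by (intro lowdeg.add lowdeg_const) auto
  ultimately have "card G \<le> card {T. T \<subseteq> {..<m} \<and> card T \<le> m div 2 + K}"
    by (intro card_agree_parity_le[of G m "\<lambda>X. 1 + P X"]) (auto simp: G_def)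
  also have "\<dots> \<le> 4 ^ r div 2 + (K + 1) * ((2 * r) choose r)"
    using card_small_sets[of r K] unfolding m_def by simp
  finally have G: "card G \<le> 4 ^ r div 2 + (K + 1) * ((2 * r) choose r)" .
  have pow: "(2 :: nat) ^ m = 4 ^ r" unfolding m_def by (simp add: power_mult)
  have finB: "finite B" using B(1) finite_subset by blast
  have "card G = 4 ^ r - card B"
    unfolding G_def using B(1) finB by (simp add: card_Diff_subset card_Pow pow)
  then have tot: "4 ^ r \<le> card G + card B" by simp
  have "s * (8 * card B) = 8 * s * card B" by simp
  also have "\<dots> \<le> 2 ^ l * card B" using s(2) by (rule mult_le_mono1)
  also have "\<dots> \<le> s * 4 ^ r"
    using B(2) F(2) unfolding pow by (meson le_trans mult_le_mono1)
  finally have smallB: "8 * card B \<le> 4 ^ r" using s(1) by simp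
  have "(8 * (x * y))\<^sup>2 = y\<^sup>2 * (64 * x\<^sup>2)" for x y :: nat
    by (simp add: power2_eq_square)
  then have "(8 * ((K + 1) * ((2 * r) choose r)))\<^sup>2 = ((2 * r) choose r)\<^sup>2 * (64 * (K + 1)\<^sup>2)" .
  also have "\<dots> \<le> ((2 * r) choose r)\<^sup>2 * (2 * r + 1)"
    using r unfolding K_def by (intro mult_le_mono2)
  also have "\<dots> \<le> 16 ^ r" by (rule central_binomial_upper)
  also have "\<dots> = (4 ^ r)\<^sup>2" by (simp add: power2_eq_square flip: power_mult_distrib)
  finally have "8 * ((K + 1) * ((2 * r) choose r)) \<le> 4 ^ r"
    by (rule power2_le_imp_le) simp
  moreover have "(0 :: nat) < 4 ^ r" by simp
  ultimately show False using G tot smallB by linarith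
qed

section \<open>Small circuits for parity\<close>

lemma odd_card_blocks:
  fixes a r q :: nat
  shows "odd (card {i \<in> {a..<a + r * q}. p i}) \<longleftrightarrow>
     odd (card {j. j < r \<and> odd (card {i \<in> {a + j * q..<a + j * q + q}. p i})})"
proof (induction r)
  case 0
  then show ?case by simp
next
  case (Suc r)
  define o' where "o' j \<longleftrightarrow> odd (card {i \<in> {a + j * q..<a + j * q + q}. p i})" for j
  define A where "A = {i \<in> {a..<a + r * q}. p i}"
  define B where "B = {i \<in> {a + r * q..<a + r * q + q}. p i}"
  have "{i \<in> {a..<a + Suc r * q}. p i} = A \<union> B" unfolding A_def B_def by auto
  moreover have "card (A \<union> B) = card A + card B"
    by (rule card_Un_disjoint) (auto simp: A_def B_def)
  moreover have "o' r \<longleftrightarrow> odd (card B)" unfolding o'_def B_def ..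
  ultimately have 1: "odd (card {i \<in> {a..<a + Suc r * q}. p i}) \<longleftrightarrow> (odd (card A) \<noteq> o' r)"
    by simp
  define C where "C = {j. j < r \<and> o' j}"
  have C: "finite C" "r \<notin> C" unfolding C_def by auto
  have "{j. j < Suc r \<and> o' j} = (if o' r then insert r C else C)"
    unfolding C_def by (auto simp: less_Suc_eq)
  then have 2: "odd (card {j. j < Suc r \<and> o' j}) \<longleftrightarrow> (odd (card C) \<noteq> o' r)" using C by simp
  have "odd (card A) \<longleftrightarrow> odd (card C)" using Suc unfolding A_def C_def o'_def .
  then show ?case using 1 2 unfolding o'_def by simp
qed

text \<open>
  \<open>r ^ Suc K\<close> bits are cut into \<open>r\<close> blocks of \<open>r ^ K\<close> bits, and the parity of the \<open>r\<close> block parities is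
  written in disjunctive normal form. This costs two levels and a factor \<open>4 ^ (r + 1)\<close> in size.
\<close>

lemma parity_upper_bound:
  "a + r ^ K \<le> n \<Longrightarrow> computes n (2 * K) ((4 ^ (r + 1)) ^ K) (parity a (r ^ K))"
proof (induction K arbitrary: a)
  case 0
  have "{i \<in> {a..<a + 1}. x i} = (if x a then {a} else {})" for x :: "nat \<Rightarrow> bool" by auto
  then have "parity a (r ^ 0) = (\<lambda>x. x a)" unfolding parity_def fun_eq_iff by simp
  moreover have "(\<lambda>x. x a) \<in> lits n" using 0 by (intro lits_pos) simp
  ultimately show ?case by (simp add: computes_lit)
next
  case (Suc K)
  define s where "s = ((4 :: nat) ^ (r + 1)) ^ K"
  define u where "u j = parity (a + j * r ^ K) (r ^ K)" for j
  define v where "v T j = (if j \<in> T then u j else (\<lambda>x. \<not> u j x))" for T j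
  define c where "c T = conj_of (v T ` {..<r})" for T
  define O' where "O' = {T. T \<subseteq> {..<r} \<and> odd (card T)}"
  have "computes n (2 * K) s (u j)" if j: "j < r" for j
  proof -
    have "j * r ^ K + r ^ K \<le> r ^ Suc K"
      using mult_le_mono1[of "Suc j" r "r ^ K"] j by (simp add: add.commute)
    then show ?thesis unfolding u_def s_def using Suc.prems by (intro Suc.IH) linarith
  qed
  then have v: "computes n (2 * K) s (v T j)" if "j < r" for T j
    unfolding v_def using that computes_not[of n "2 * K" s "u j"] by (cases "j \<in> T") simp_all
  have c: "computes n (Suc (2 * K)) (Suc (r * s)) (c T)" for T
  proof -
    have "computes n (2 * K) s w" if "w \<in> v T ` {..<r}" for w
      using that v by blast
    then have *: "computes n (Suc (2 * K)) (Suc (card (v T ` {..<r}) * s)) (c T)"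
      unfolding c_def by (intro computes_gate) simp_all
    have "card (v T ` {..<r}) \<le> r" using card_image_le[of "{..<r}" "v T"] by simp
    then have "Suc (card (v T ` {..<r}) * s) \<le> Suc (r * s)" by simp
    then show ?thesis by (rule computes_mono[OF * order_refl order_refl])
  qed
  have finO: "finite O'" unfolding O'_def by simp
  have gate: "computes n (Suc (Suc (2 * K))) (Suc (card (c ` O') * Suc (r * s))) (disj_of (c ` O'))"
  proof (rule computes_gate)
    show "computes n (Suc (2 * K)) (Suc (r * s)) w" if "w \<in> c ` O'" for w
      using that c by blast
  qed (use finO in simp_all)
  have size: "Suc (card (c ` O') * Suc (r * s)) \<le> (4 ^ (r + 1)) ^ Suc K"
  proof -
    have "card (c ` O') \<le> card O'" using finO by (rule card_image_le)
    also have "\<dots> \<le> card (Pow {..<r})" unfolding O'_def by (intro card_mono) auto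
    finally have "card (c ` O') \<le> 2 ^ r" by (simp add: card_Pow)
    then have "Suc (card (c ` O') * Suc (r * s)) \<le> Suc (2 ^ r * Suc (r * s))"
      unfolding Suc_le_mono by (rule mult_le_mono1)
    also have "\<dots> \<le> Suc (2 ^ r * Suc (2 ^ r * s))"
      unfolding Suc_le_mono
      by (intro mult_le_mono2 iffD2[OF Suc_le_mono] mult_le_mono1 less_imp_le less_exp)
    also have "\<dots> = 1 + 2 ^ r + 2 ^ r * 2 ^ r * s" by simp
    also have "\<dots> = 1 + 2 ^ r + 4 ^ r * s"
    proof -
      have "(2 :: nat) ^ r * 2 ^ r = 4 ^ r" by (simp flip: power_mult_distrib)
      then show ?thesis by simp
    qed
    also have "\<dots> \<le> 4 * (4 ^ r * s)"
    proof -
      have s: "1 \<le> s" unfolding s_def by simp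
      have "(2 :: nat) ^ r \<le> 4 ^ r" by (rule power_mono) auto
      also have "\<dots> \<le> 4 ^ r * s" using s by simp
      finally have "2 ^ r \<le> 4 ^ r * s" .
      moreover have "1 \<le> 4 ^ r * s" using s by simp
      ultimately show ?thesis by linarith
    qed
    also have "4 * (4 ^ r * s) = (4 ^ (r + 1)) ^ Suc K" unfolding s_def by simp
    finally show ?thesis .
  qed
  have eq: "disj_of (c ` O') = parity a (r ^ Suc K)"
  proof
    fix x
    define T where "T = {j. j < r \<and> u j x}"
    have cS: "c S x \<longleftrightarrow> S = T" if "S \<subseteq> {..<r}" for S
    proof -
      have "v S j x \<longleftrightarrow> (j \<in> S \<longleftrightarrow> u j x)" for j unfolding v_def by simp
      then have "c S x \<longleftrightarrow> (\<forall>j\<in>{..<r}. j \<in> S \<longleftrightarrow> u j x)" unfolding c_def conj_of_def by simp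
      also have "\<dots> \<longleftrightarrow> S = T" using that unfolding T_def by blast
      finally show ?thesis .
    qed
    have "(\<exists>S\<in>O'. c S x) \<longleftrightarrow> (\<exists>S\<in>O'. S = T)"
      by (intro bex_cong refl cS) (simp add: O'_def)
    then have "disj_of (c ` O') x \<longleftrightarrow> T \<in> O'" unfolding disj_of_def by simp
    also have "\<dots> \<longleftrightarrow> odd (card T)" unfolding O'_def T_def by auto
    also have "\<dots> \<longleftrightarrow> parity a (r ^ Suc K) x"
      unfolding T_def u_def parity_def power_Suc by (rule odd_card_blocks[symmetric])
    finally show "disj_of (c ` O') x = parity a (r ^ Suc K) x" .
  qed
  have "2 * Suc K = Suc (Suc (2 * K))" by simp
  then show ?case
    using computes_mono[OF gate order_refl order_refl size] unfolding eq by (simp only:)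
qed

section \<open>Collapse of one level propagates upwards\<close>

lemma gate_over_mono:
  assumes "gate_over n F e f" "F \<subseteq> F'"
  shows "gate_over n F' e f"
proof -
  obtain j W where j: "j < e" "W \<subseteq> avail n F j" "f = conj_of W \<or> f = disj_of W"
    using assms(1) unfolding gate_over_def by blast
  have "avail n F j \<subseteq> avail n F' j" using assms(2) by (intro avail_mono) auto
  then show ?thesis using j by (intro gate_overI[of j e W]) auto
qed

text \<open>
  The gates of level at most \<open>k + 1\<close> are replaced by the circuits of depth \<open>k\<close> that \<open>low\<close> provides for
  their functions, and all higher gates move down by one level.
\<close>

lemma computes_bottom_replace:
  assumes low: "\<And>g. computes n (Suc k) s g \<Longrightarrow> computes n k N g"
    and f: "computes n (Suc k') s f" and "k \<le> k'"
  shows "computes n k' (s + s * N) f"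
proof -
  obtain F where F: "layered n F" "card F \<le> s" "f \<in> avail n F (Suc k')"
    using f unfolding computes_def by blast
  have fin: "finite F" using F(1) by (rule layered_finite)
  define L where "L = {p \<in> F. fst p \<le> Suc k}"
  have "\<exists>B. layered n B \<and> card B \<le> N \<and> snd p \<in> avail n B k" if "p \<in> L" for p
  proof -
    have "snd p \<in> avail n F (Suc k)"
      using that unfolding L_def by (intro avail_gate[of "fst p"]) auto
    then have "computes n (Suc k) s (snd p)" using F(1,2) unfolding computes_def by blast
    then have "computes n k N (snd p)" by (rule low)
    then show ?thesis unfolding computes_def .
  qed
  then obtain B where B: "\<And>p. p \<in> L \<Longrightarrow> layered n (B p) \<and> card (B p) \<le> N \<and> snd p \<in> avail n (B p) k"
    by metis
  define U where "U = (\<Union>p\<in>L. B p)"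
  \<comment> \<open>\<open>U\<close> collects the new bottom circuits, and \<open>D\<close> the remaining gates one level lower.\<close>
  define D where "D = map_prod (\<lambda>e. e - 1) id ` (F - L)"
  have finL: "finite L" unfolding L_def using fin by simp
  have U: "layered n U" unfolding U_def using finL B by (intro layered_Union) auto
  have av: "w \<in> avail n (D \<union> U) i" if w: "w \<in> avail n F (Suc i)" and "k \<le> i" for w i
    using w
  proof (cases rule: availE)
    case 1
    then show ?thesis by (rule avail_lit)
  next
    case (2 e)
    show ?thesis
    proof (cases "e \<le> Suc k")
      case True
      then have p: "(e, w) \<in> L" using 2 unfolding L_def by simp
      then have "w \<in> avail n (B (e, w)) k" using B by fastforce
      moreover have "avail n (B (e, w)) k \<subseteq> avail n (D \<union> U) i"
        using p \<open>k \<le> i\<close> unfolding U_def by (intro avail_mono) auto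
      ultimately show ?thesis by blast
    next
      case False
      then have "(e, w) \<in> F - L" using 2 unfolding L_def by simp
      then have "map_prod (\<lambda>e. e - 1) id (e, w) \<in> D" unfolding D_def by (rule imageI)
      then have "(e - 1, w) \<in> D \<union> U" by simp
      then show ?thesis using 2(1) by (intro avail_gate[of "e - 1"]) auto
    qed
  qed
  have "layered n (D \<union> U)"
  proof (rule layeredI)
    show "finite (D \<union> U)" using fin layered_finite[OF U] unfolding D_def by simp
  next
    fix e g assume "(e, g) \<in> D \<union> U"
    then show "gate_over n (D \<union> U) e g"
    proof
      assume "(e, g) \<in> U"
      then have "gate_over n U e g" using U unfolding layered_def by blast
      then show ?thesis by (rule gate_over_mono) simp
    next
      assume "(e, g) \<in> D"
      then obtain e' where e': "(e', g) \<in> F" "Suc k < e'" "e = e' - 1"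
        unfolding D_def L_def by fastforce
      obtain j W where j: "j < e'" "W \<subseteq> avail n F j" "g = conj_of W \<or> g = disj_of W"
        using layeredE[OF F(1) e'(1)] .
      have "avail n F j \<subseteq> avail n F (Suc (e' - 2))" using j(1) by (intro avail_mono) auto
      then have "W \<subseteq> avail n (D \<union> U) (e' - 2)" using j(2) av[of _ "e' - 2"] e'(2) by auto
      then show ?thesis using j(3) e'(2,3) by (intro gate_overI[of "e' - 2"]) auto
    qed
  qed
  moreover have "card (D \<union> U) \<le> s + s * N"
  proof -
    have "card D \<le> card (F - L)" unfolding D_def using fin by (intro card_image_le) simp
    also have "\<dots> \<le> card F" using fin by (intro card_mono) auto
    finally have "card D \<le> s" using F(2) by simp
    moreover have "card U \<le> s * N"
    proof -
      have "card U \<le> (\<Sum>p\<in>L. card (B p))" unfolding U_def using finL by (rule card_UN_le)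
      also have "\<dots> \<le> (\<Sum>p\<in>L. N)" using B by (intro sum_mono) auto
      also have "\<dots> = card L * N" by simp
      also have "card L \<le> card F" unfolding L_def using fin by (intro card_mono) auto
      finally show ?thesis using F(2) by (meson le_trans mult_le_mono1)
    qed
    ultimately show ?thesis using card_Un_le[of D U] by linarith
  qed
  moreover have "f \<in> avail n (D \<union> U) k'" using av F(3) assms(3) by blast
  ultimately show ?thesis unfolding computes_def by blast
qed

text \<open>
  A single parameter bounds both the number of variables and the size. Since the circuit grows in
  each step, it is then regarded as a circuit on more variables, so that \<open>low\<close> applies again.
\<close>

lemma collapse:
  assumes low: "\<And>n f. computes n (Suc k) n f \<Longrightarrow> computes n k ((n + 2) ^ c) f"
  shows "\<exists>c'. \<forall>n f. computes n (k + j) n f \<longrightarrow> computes ((n + 2) ^ c') k ((n + 2) ^ c') f"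
proof (induction j)
  case 0
  have "computes ((n + 2) ^ 1) k ((n + 2) ^ 1) f" if "computes n (k + 0) n f" for n f
    using that by (rule computes_mono) auto
  then show ?case by blast
next
  case (Suc j)
  then obtain c' where
    IH: "\<And>n f. computes n (k + j) n f \<Longrightarrow> computes ((n + 2) ^ c') k ((n + 2) ^ c') f" by blast
  have "computes ((n + 2) ^ ((c + 3) * c')) k ((n + 2) ^ ((c + 3) * c')) f"
    if f: "computes n (k + Suc j) n f" for n f
  proof -
    define M where "M = (n + 2) ^ (c + 2)"
    define N where "N = (n + 2) ^ c"
    have "computes n (k + j) (n + n * N) f"
      using low f unfolding N_def by (intro computes_bottom_replace[of n k n]) auto
    moreover have "1 \<le> N" unfolding N_def by simp
    have MN: "M = (n + 2) * (n + 2) * N"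
      unfolding M_def N_def by (simp only: power_add power2_eq_square mult_ac)
    have "n + n * N \<le> M"
    proof -
      have "n \<le> n * N" using \<open>1 \<le> N\<close> by simp
      then have "n + n * N \<le> 2 * n * N" by simp
      also have "\<dots> \<le> M" unfolding MN by (rule mult_le_mono1) simp
      finally show ?thesis .
    qed
    moreover have "n \<le> M" using \<open>n + n * N \<le> M\<close> by simp
    ultimately have "computes M (k + j) M f" using computes_mono by blast
    then have "computes ((M + 2) ^ c') k ((M + 2) ^ c') f" by (rule IH)
    moreover have "M + 2 \<le> (n + 2) ^ (c + 3)"
    proof -
      have "2 \<le> M" unfolding M_def using power_increasing[of 1 "c + 2" "n + 2"] by simp
      then have "M + 2 \<le> 2 * M" by simp
      also have "\<dots> \<le> (n + 2) * M" by simp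
      also have "\<dots> = (n + 2) ^ (c + 3)" unfolding M_def by (simp add: numeral_3_eq_3)
      finally show ?thesis .
    qed
    then have le: "(M + 2) ^ c' \<le> (n + 2) ^ ((c + 3) * c')"
      unfolding power_mult by (rule power_mono) simp
    ultimately show ?thesis using computes_mono[OF _ le order_refl le] by blast
  qed
  then show ?case by blast
qed

lemma no_collapse:
  assumes low: "\<And>n f. computes n (Suc k) n f \<Longrightarrow> computes n k ((n + 2) ^ c) f"
  shows False
proof -
  define K where "K = 2 * k + 1"
  obtain c' where
    c': "\<And>n f. computes n (k + (3 * k + 2)) n f \<Longrightarrow> computes ((n + 2) ^ c') k ((n + 2) ^ c') f"
    using collapse[OF low, where j = "3 * k + 2"] by blast
  \<comment> \<open>With these values the collapsed circuit has size at most \<open>4 ^ (a * r)\<close>, and its approximation has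
    degree \<open>(2 * l) ^ k \<le> b * r ^ k\<close>. As \<open>r ^ K = r * (r ^ k)\<^sup>2\<close>, the choice of \<open>r\<close> makes the number of bits
    at least the square of eight times one plus this degree. It also makes that number even.\<close>
  define a where "a = (2 * K + 1) * c'"
  define b where "b = (4 * a + 6) ^ k"
  define r where "r = 64 * (b + 1)\<^sup>2"
  define l where "l = 2 * (a * r) + 3"
  define n where "n = ((4 :: nat) ^ (r + 1)) ^ K"
  have r1: "1 \<le> r" unfolding r_def by simp
  have "r < 2 ^ r" by (rule less_exp)
  also have "\<dots> \<le> 4 ^ r" by (rule power_mono) auto
  also have "\<dots> \<le> 4 ^ (r + 1)" by simp
  finally have "r \<le> 4 ^ (r + 1)" by simp
  then have rn: "r ^ K \<le> n" unfolding n_def by (rule power_mono) simp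
  have "computes n (2 * K) n (parity 0 (r ^ K))"
    using parity_upper_bound[of 0 r K n] rn unfolding n_def by simp
  moreover have "2 * K = k + (3 * k + 2)" unfolding K_def by simp
  ultimately have "computes ((n + 2) ^ c') k ((n + 2) ^ c') (parity 0 (r ^ K))" using c' by simp
  moreover have "(n + 2) ^ c' \<le> 4 ^ (a * r)"
  proof -
    have "1 \<le> n" unfolding n_def by simp
    then have "n + 2 \<le> 4 * n" by simp
    then have "(n + 2) ^ c' \<le> (4 * n) ^ c'" by (rule power_mono) simp
    also have "4 * n = 4 ^ ((r + 1) * K + 1)"
      unfolding n_def power_mult[symmetric] by (simp only: Suc_eq_plus1[symmetric] power_Suc)
    also have "(4 ^ ((r + 1) * K + 1)) ^ c' = (4 :: nat) ^ (((r + 1) * K + 1) * c')"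
      by (simp only: power_mult)
    also have "\<dots> \<le> 4 ^ (a * r)"
    proof (rule power_increasing)
      have "(r + 1) * K + 1 \<le> (2 * r) * K + r" using r1 by (intro add_mono mult_le_mono1) auto
      also have "\<dots> = (2 * K + 1) * r" by (simp add: algebra_simps)
      finally have "((r + 1) * K + 1) * c' \<le> (2 * K + 1) * r * c'" by (rule mult_le_mono1)
      then show "((r + 1) * K + 1) * c' \<le> a * r" unfolding a_def by (simp only: mult_ac)
    qed simp
    finally show ?thesis .
  qed
  ultimately have comp: "computes ((n + 2) ^ c') k (4 ^ (a * r)) (parity 0 (r ^ K))"
    using computes_mono[OF _ order_refl order_refl] by blast
  have "even (r ^ K)" unfolding r_def K_def by simp
  then obtain h where h: "r ^ K = 2 * h" by blast
  show False
  proof (rule parity_lower_bound)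
    show "computes ((n + 2) ^ c') k (4 ^ (a * r)) (parity 0 (2 * h))" using comp unfolding h .
    show "(0 :: nat) < 4 ^ (a * r)" by simp
    show "8 * 4 ^ (a * r) \<le> (2 :: nat) ^ l" unfolding l_def by (simp add: power_add power_mult)
    have "2 * l \<le> (4 * a + 6) * r" unfolding l_def using r1 by (simp add: algebra_simps)
    then have "(2 * l) ^ k \<le> ((4 * a + 6) * r) ^ k" by (rule power_mono) simp
    also have "\<dots> = b * r ^ k" unfolding b_def by (simp only: power_mult_distrib)
    finally have "(2 * l) ^ k \<le> b * r ^ k" .
    moreover have "1 \<le> r ^ k" using r1 by simp
    ultimately have "(2 * l) ^ k + 1 \<le> (b + 1) * r ^ k" unfolding add_mult_distrib by linarith
    then have "((2 * l) ^ k + 1)\<^sup>2 \<le> ((b + 1) * r ^ k)\<^sup>2" by (rule power_mono) simp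
    then have "64 * ((2 * l) ^ k + 1)\<^sup>2 \<le> 64 * ((b + 1) * r ^ k)\<^sup>2" by simp
    also have "\<dots> = r * (r ^ k)\<^sup>2" unfolding r_def by (simp only: power_mult_distrib mult_ac)
    also have "\<dots> = r ^ K"
      unfolding K_def
      by (simp only: power_mult[symmetric] Suc_eq_plus1[symmetric] power_Suc mult.commute)
    finally show "64 * ((2 * l) ^ k + 1)\<^sup>2 \<le> 2 * h + 1" unfolding h by simp
  qed
qed

section \<open>The depth hierarchy\<close>

lemma finite_computes: "finite {f. computes n k s f}"
proof -
  define \<tau> where "\<tau> f = {X \<in> Pow {..<n}. f (\<lambda>i. i \<in> X)}" for f :: "(nat \<Rightarrow> bool) \<Rightarrow> bool"
  have "inj_on \<tau> {f. computes n k s f}"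
  proof (rule inj_onI, rule ext)
    fix f g x assume f: "f \<in> {f. computes n k s f}" and g: "g \<in> {f. computes n k s f}"
      and eq: "\<tau> f = \<tau> g"
    define X where "X = {i. i < n \<and> x i}"
    have "f x = f (\<lambda>i. i \<in> X)" using f unfolding X_def by (intro computes_local[of n k s f]) auto
    moreover have "g x = g (\<lambda>i. i \<in> X)"
      using g unfolding X_def by (intro computes_local[of n k s g]) auto
    moreover have "X \<in> Pow {..<n}" unfolding X_def by auto
    then have "f (\<lambda>i. i \<in> X) \<longleftrightarrow> g (\<lambda>i. i \<in> X)" using eq unfolding \<tau>_def by blast
    ultimately show "f x = g x" by simp
  qed
  moreover have "finite (\<tau> ` {f. computes n k s f})"
    by (rule finite_subset[of _ "Pow (Pow {..<n})"]) (auto simp: \<tau>_def)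
  ultimately show ?thesis by (rule finite_imageD[rotated])
qed

text \<open>
  There are only finitely many candidates, and they are compared by the least size of a depth-\<open>k\<close>
  circuit. A candidate without any such circuit is hardest for trivial reasons.
\<close>

lemma exists_hardest:
  "\<exists>h. computes n k' s' h \<and>
     (\<forall>f s. computes n k' s' f \<longrightarrow> computes n k s h \<longrightarrow> computes n k s f)"
proof (cases "\<exists>h. computes n k' s' h \<and> (\<forall>s. \<not> computes n k s h)")
  case True
  then show ?thesis by blast
next
  case False
  define S where "S = {f. computes n k' s' f}"
  define \<mu> where "\<mu> f = (LEAST s. computes n k s f)" for f
  have \<mu>: "computes n k (\<mu> f) f" if "f \<in> S" for f
    unfolding \<mu>_def using that False LeastI_ex[of "\<lambda>s. computes n k s f"] unfolding S_def by blast
  have finS: "finite S" unfolding S_def by (rule finite_computes)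
  have "(\<lambda>x. True) \<in> S" unfolding S_def using computes_lit[OF lits_const] by blast
  then have "Max (\<mu> ` S) \<in> \<mu> ` S" using finS by (intro Max_in) auto
  then obtain h where h: "h \<in> S" "\<mu> h = Max (\<mu> ` S)" by auto
  have best: "computes n k s f" if "f \<in> S" "computes n k s h" for f s
  proof -
    have "\<mu> f \<le> \<mu> h" unfolding h(2) using finS that(1) by simp
    also have "\<mu> h \<le> s" unfolding \<mu>_def using that(2) by (rule Least_le)
    finally show ?thesis by (rule computes_mono[OF \<mu>[OF that(1)] order_refl order_refl])
  qed
  show ?thesis
  proof (intro exI[of _ h] conjI allI impI)
    show "computes n k' s' h" using h(1) unfolding S_def by simp
  next
    fix f s assume "computes n k' s' f" "computes n k s h"
    then show "computes n k s f" using best unfolding S_def by simp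
  qed
qed

lemma depth_hierarchy:
  "\<exists>h. (\<forall>n. computes n (Suc k) n (h n)) \<and> \<not> (\<exists>c. \<forall>n. computes n k ((n + 2) ^ c) (h n))"
proof -
  define hardest where "hardest n h \<longleftrightarrow> computes n (Suc k) n h \<and>
      (\<forall>f s. computes n (Suc k) n f \<longrightarrow> computes n k s h \<longrightarrow> computes n k s f)" for n h
  define h where "h n = (SOME h. hardest n h)" for n
  have "\<exists>h. hardest n h" for n unfolding hardest_def by (rule exists_hardest)
  then have h: "hardest n (h n)" for n unfolding h_def by (rule someI_ex)
  have "\<not> (\<exists>c. \<forall>n. computes n k ((n + 2) ^ c) (h n))"
  proof
    assume "\<exists>c. \<forall>n. computes n k ((n + 2) ^ c) (h n)"
    then obtain c where c: "\<forall>n. computes n k ((n + 2) ^ c) (h n)" by (elim exE)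
    have "computes n k ((n + 2) ^ c) f" if "computes n (Suc k) n f" for n f
      using h[of n] c that unfolding hardest_def by simp
    then show False by (rule no_collapse)
  qed
  moreover have "computes n (Suc k) n (h n)" for n using h[of n] unfolding hardest_def by simp
  ultimately show ?thesis by (intro exI[of _ h] conjI allI)
qed

lemma computes_conj_form:
  assumes "computes n (Suc k) s f"
  obtains g F W where "g = f \<or> g = (\<lambda>x. \<not> f x)" "layered n F" "card F \<le> s"
    "W \<subseteq> avail n F k" "g = conj_of W"
proof -
  obtain F where F: "layered n F" "card F \<le> s" "f \<in> avail n F (Suc k)"
    using assms unfolding computes_def by blast
  have lit: "f = conj_of {f}" unfolding conj_of_def by simp
  from F(3) show thesis
  proof (cases rule: availE)
    case 1
    then have "{f} \<subseteq> avail n F k" by (simp add: avail_lit)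
    then show thesis using that[OF disjI1[OF refl] F(1,2) _ lit] by blast
  next
    case (2 e)
    obtain j W where j: "j < e" "W \<subseteq> avail n F j" "f = conj_of W \<or> f = disj_of W"
      using layeredE[OF F(1) 2(2)] .
    have "avail n F j \<subseteq> avail n F k" using j(1) 2(1) by (intro avail_mono) auto
    then have W: "W \<subseteq> avail n F k" using j(2) by simp
    from j(3) show thesis
    proof
      assume "f = conj_of W"
      then show thesis by (rule that[OF disjI1[OF refl] F(1,2) W])
    next
      assume f: "f = disj_of W"
      \<comment> \<open>Negating the whole circuit turns its output disjunction into a conjunction.\<close>
      define N where "N = (\<lambda>f x. \<not> f x :: bool) ` W"
      define F' where "F' = map_prod id (\<lambda>f x. \<not> f x) ` F"
      have "layered n F'" unfolding F'_def by (rule layered_gatewise[OF F(1) gatewise_not])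
      moreover have "card F' \<le> s"
        unfolding F'_def by (rule le_trans[OF card_image_le[OF layered_finite[OF F(1)]] F(2)])
      moreover have "N \<subseteq> avail n F' k"
        unfolding N_def F'_def
      proof (rule image_subsetI)
        fix w assume "w \<in> W"
        then have "w \<in> avail n F k" using W by (rule rev_subsetD)
        from avail_gatewise[OF gatewise_not this]
        show "(\<lambda>x. \<not> w x) \<in> avail n (map_prod id (\<lambda>f x. \<not> f x) ` F) k" .
      qed
      moreover have "(\<lambda>x. \<not> f x) = conj_of N"
        unfolding f N_def by (simp add: conj_of_def disj_of_def fun_eq_iff)
      ultimately show thesis by (intro that[OF disjI2[OF refl]])
    qed
  qed
qed

section \<open>Inputs of the form \<open>y\<^sub>0, \<not> y\<^sub>0, y\<^sub>1, \<not> y\<^sub>1, \<dots>\<close>\<close>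

definition paired :: "nat \<Rightarrow> (nat \<Rightarrow> bool) \<Rightarrow> bool" where
  "paired n x \<longleftrightarrow> (\<forall>i<n div 2. x (2 * i) \<noteq> x (2 * i + 1))"

definition clauses :: "nat \<Rightarrow> ((nat \<Rightarrow> bool) \<Rightarrow> bool) set" where
  "clauses n = (\<Union>i<n div 2. {disj_of {\<lambda>x. x (2 * i), \<lambda>x. x (2 * i + 1)},
     disj_of {\<lambda>x. \<not> x (2 * i), \<lambda>x. \<not> x (2 * i + 1)}})"

lemma conj_of_clauses: "conj_of (clauses n) = paired n"
  unfolding clauses_def paired_def conj_of_def disj_of_def fun_eq_iff by auto

lemma layered_clauses: "layered n (Pair 1 ` clauses n)"
proof (rule layeredI)
  show "finite (Pair 1 ` clauses n)" unfolding clauses_def by simp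
next
  fix e :: nat and f assume "(e, f) \<in> Pair 1 ` clauses n"
  then have e: "e = 1" and "f \<in> clauses n" by auto
  then obtain i where i: "i < n div 2" "f = disj_of {\<lambda>x. x (2 * i), \<lambda>x. x (2 * i + 1)} \<or>
      f = disj_of {\<lambda>x. \<not> x (2 * i), \<lambda>x. \<not> x (2 * i + 1)}" unfolding clauses_def by blast
  then have lt: "2 * i < n" "2 * i + 1 < n" by auto
  have "(\<lambda>x. x j) \<in> lits n" "(\<lambda>x. \<not> x j) \<in> lits n" if "j < n" for j
    using that by (intro lits_pos lits_neg; simp)+
  then have "\<exists>W. W \<subseteq> avail n (Pair 1 ` clauses n) 0 \<and> (f = conj_of W \<or> f = disj_of W)"
    using i(2) lt by (metis avail_lit empty_subsetI insert_subset)
  then show "gate_over n (Pair 1 ` clauses n) e f" unfolding e by (metis gate_overI zero_less_one)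
qed

lemma card_clauses: "card (clauses n) \<le> n"
proof -
  have "card (clauses n) \<le> (\<Sum>i<n div 2. card {disj_of {\<lambda>x. x (2 * i), \<lambda>x. x (2 * i + 1)},
     disj_of {\<lambda>x. \<not> x (2 * i), \<lambda>x. \<not> x (2 * i + 1)}})"
    unfolding clauses_def by (rule card_UN_le) simp
  also have "\<dots> \<le> (\<Sum>i<n div 2. 2)" by (intro sum_mono card_insert_le_m1) auto
  also have "\<dots> \<le> n" by simp
  finally show ?thesis .
qed

text \<open>
  The clauses have depth one, so they can be fed into the output gate of the conjunction next to \<open>W\<close>.
\<close>

lemma computes_and_paired:
  assumes "layered (n div 2) F" "card F \<le> n div 2" "W \<subseteq> avail (n div 2) F k" "1 \<le> k"
  shows "computes n (Suc k) (2 * n + 1) (\<lambda>x. paired n x \<and> conj_of W (\<lambda>i. x (2 * i)))"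
proof -
  define \<Phi> :: "((nat \<Rightarrow> bool) \<Rightarrow> bool) \<Rightarrow> (nat \<Rightarrow> bool) \<Rightarrow> bool"
    where "\<Phi> = (\<lambda>f x. f (\<lambda>i. x (2 * i)))"
  have "\<Phi> ` lits (n div 2) \<subseteq> lits n"
  proof (rule image_subsetI)
    fix f assume "f \<in> lits (n div 2)"
    then consider b where "f = (\<lambda>x. b)" | i where "i < n div 2" "f = (\<lambda>x. x i)"
      | i where "i < n div 2" "f = (\<lambda>x. \<not> x i)" unfolding lits_iff by blast
    then show "\<Phi> f \<in> lits n"
      unfolding \<Phi>_def by cases (simp_all add: lits_const lits_pos lits_neg)
  qed
  then have \<Phi>: "gatewise (n div 2) n \<Phi>" unfolding \<Phi>_def by (rule gatewise_subst)
  define F' where "F' = map_prod id \<Phi> ` F \<union> Pair 1 ` clauses n"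
  have lay: "layered n F'"
    unfolding F'_def by (intro layered_Un layered_gatewise[OF assms(1) \<Phi>] layered_clauses)
  have "card F' \<le> card (map_prod id \<Phi> ` F) + card (Pair (1 :: nat) ` clauses n)"
    unfolding F'_def by (rule card_Un_le)
  moreover have "card (map_prod id \<Phi> ` F) \<le> n div 2"
    by (rule le_trans[OF card_image_le[OF layered_finite[OF assms(1)]] assms(2)])
  moreover have "card (Pair (1 :: nat) ` clauses n) \<le> n"
    by (rule le_trans[OF card_image_le card_clauses]) (simp add: clauses_def)
  ultimately have card: "card F' \<le> 2 * n" by linarith
  define V where "V = \<Phi> ` W \<union> clauses n"
  have "\<Phi> ` W \<subseteq> avail n F' k"
    using avail_gatewise[OF \<Phi>] assms(3) avail_mono[of n n "map_prod id \<Phi> ` F" F' k k]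
    unfolding F'_def by blast
  moreover have "clauses n \<subseteq> avail n F' k"
    unfolding F'_def using assms(4) by (auto intro: avail_gate[of 1])
  ultimately have V: "V \<subseteq> avail n F' k" unfolding V_def by blast
  have "conj_of V x \<longleftrightarrow> paired n x \<and> conj_of W (\<lambda>i. x (2 * i))" for x
  proof -
    have "conj_of V x \<longleftrightarrow> conj_of (\<Phi> ` W) x \<and> conj_of (clauses n) x"
      unfolding V_def conj_of_def by blast
    moreover have "conj_of (\<Phi> ` W) x \<longleftrightarrow> conj_of W (\<lambda>i. x (2 * i))"
      unfolding conj_of_def \<Phi>_def by simp
    ultimately show ?thesis unfolding conj_of_clauses by blast
  qed
  then have g: "(\<lambda>x. paired n x \<and> conj_of W (\<lambda>i. x (2 * i))) = conj_of V" by (simp add: fun_eq_iff)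
  have "layered n (insert (Suc k, conj_of V) F')"
    using lay V by (intro layered_insert[of n F' k]) auto
  moreover have "card (insert (Suc k, conj_of V) F') \<le> 2 * n + 1"
    using card card_insert_if[OF layered_finite[OF lay], of "(Suc k, conj_of V)"] by simp
  moreover have "conj_of V \<in> avail n (insert (Suc k, conj_of V) F') (Suc k)"
    by (rule avail_gate[of "Suc k"]) auto
  ultimately show ?thesis unfolding g computes_def by blast
qed

lemma paired_constant_imp:
  fixes h :: "(nat \<Rightarrow> bool) \<Rightarrow> bool"
  assumes const: "restricted n \<rho> (paired n) constant_on cube (free_vars n \<rho>)"
    and local: "\<And>x y. (\<And>i. i < n div 2 \<Longrightarrow> x i = y i) \<Longrightarrow> h x = h y"
  shows "restricted n \<rho> (\<lambda>x. paired n x \<and> h (\<lambda>i. x (2 * i))) constant_on cube (free_vars n \<rho>)"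
proof -
  define z where "z y = (\<lambda>i \<in> {..<n}. case \<rho> i of None \<Rightarrow> y i | Some b \<Rightarrow> b)" for y
  have res: "restricted n \<rho> g = (\<lambda>y. g (z y))" for g unfolding restricted_def z_def ..
  obtain b where b: "\<And>y. y \<in> cube (free_vars n \<rho>) \<Longrightarrow> paired n (z y) = b"
    using const unfolding constant_on_def res by blast
  show ?thesis
  proof (cases b)
    case False
    then show ?thesis unfolding constant_on_def res using b by blast
  next
    case True
    have fixed: "\<rho> i \<noteq> None" if i: "i < 2 * (n div 2)" for i
    proof
      assume "\<rho> i = None"
      then have free: "i \<in> free_vars n \<rho>" unfolding free_vars_def using i by simp
      \<comment> \<open>Two inputs that differ exactly in the free variable \<open>i\<close> of a pair cannot both be paired.\<close>
      define y where "y = (\<lambda>i\<in>free_vars n \<rho>. False)"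
      define y' where "y' = y(i := True)"
      have "y \<in> cube (free_vars n \<rho>)" unfolding y_def cube_def by simp
      moreover have "y' \<in> cube (free_vars n \<rho>)"
        using free unfolding y'_def y_def cube_def by (auto simp: PiE_iff extensional_def)
      ultimately have p: "paired n (z y)" "paired n (z y')" using b True by blast+
      have diff: "z y i \<noteq> z y' i" unfolding z_def y'_def y_def
        using free \<open>\<rho> i = None\<close> i by simp
      have same: "z y j = z y' j" if "j \<noteq> i" for j
        using that unfolding z_def y'_def by (simp split: option.split)
      define q where "q = i div 2"
      have "q < n div 2" using i unfolding q_def by simp
      then have "z y (2 * q) \<noteq> z y (2 * q + 1)" "z y' (2 * q) \<noteq> z y' (2 * q + 1)"
        using p unfolding paired_def by blast+
      moreover have "i = 2 * q \<or> i = 2 * q + 1" unfolding q_def by linarith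
      ultimately show False using diff same[of "2 * q"] same[of "2 * q + 1"] by force
    qed
    have "h (\<lambda>i. z y (2 * i)) = h (\<lambda>i. z y' (2 * i))" for y y'
    proof (rule local)
      fix i assume "i < n div 2"
      then show "z y (2 * i) = z y' (2 * i)" using fixed[of "2 * i"] unfolding z_def by auto
    qed
    then have "paired n (z y) \<and> h (\<lambda>i. z y (2 * i)) \<longleftrightarrow> h (\<lambda>i. z (\<lambda>i. False) (2 * i))"
      if "y \<in> cube (free_vars n \<rho>)" for y
      using b[OF that] True by blast
    then show ?thesis unfolding constant_on_def res by blast
  qed
qed

text \<open>
  Substituting \<open>y i\<close> for \<open>x (2 * i)\<close> and \<open>\<not> y i\<close> for \<open>x (2 * i + 1)\<close> costs nothing, since literals are
  replaced by literals, and it makes every input paired.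
\<close>

lemma computes_unpair:
  assumes "computes (2 * q) k s f'"
    and f': "\<And>x. x \<in> cube {..<2 * q} \<Longrightarrow> f' x \<longleftrightarrow> paired (2 * q) x \<and> h (\<lambda>i. x (2 * i))"
    and local: "\<And>x y. (\<And>i. i < q \<Longrightarrow> x i = y i) \<Longrightarrow> h x = h y"
  shows "computes q k s h"
proof -
  define \<tau> where "\<tau> y i = (if even i then y (i div 2) else \<not> y (i div 2))"
    for y :: "nat \<Rightarrow> bool" and i :: nat
  have lits: "(\<lambda>f x. f (\<tau> x)) ` lits (2 * q) \<subseteq> lits q"
  proof (rule image_subsetI)
    fix f assume "f \<in> lits (2 * q)"
    then consider b where "f = (\<lambda>x. b)" | i where "i < 2 * q" "f = (\<lambda>x. x i)"
      | i where "i < 2 * q" "f = (\<lambda>x. \<not> x i)" unfolding lits_iff by blast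
    then show "(\<lambda>x. f (\<tau> x)) \<in> lits q"
    proof cases
      case (1 b)
      then show ?thesis by (simp add: lits_const)
    next
      case (2 i)
      then have "i div 2 < q" by linarith
      then show ?thesis
        unfolding 2(2) \<tau>_def by (cases "even i") (simp_all add: lits_pos lits_neg)
    next
      case (3 i)
      then have "i div 2 < q" by linarith
      then show ?thesis
        unfolding 3(2) \<tau>_def by (cases "even i") (simp_all add: lits_pos lits_neg)
    qed
  qed
  have "computes q k s (\<lambda>y. f' (\<tau> y))" using computes_subst[OF assms(1) lits] .
  moreover have "f' (\<tau> y) = h y" for y
  proof -
    define x where "x = restrict (\<tau> y) {..<2 * q}"
    have "f' (\<tau> y) = f' x" unfolding x_def by (rule computes_local[OF assms(1)]) simp
    also have "\<dots> \<longleftrightarrow> paired (2 * q) x \<and> h (\<lambda>i. x (2 * i))"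
      by (rule f') (simp add: x_def cube_def)
    finally have "f' (\<tau> y) \<longleftrightarrow> paired (2 * q) x \<and> h (\<lambda>i. x (2 * i))" .
    moreover have "paired (2 * q) x" unfolding paired_def x_def \<tau>_def by simp
    moreover have "h (\<lambda>i. x (2 * i)) = h y" by (rule local) (simp add: x_def \<tau>_def)
    ultimately show ?thesis by blast
  qed
  ultimately show ?thesis by simp
qed

theorem theorem5p7:
  fixes d :: nat
  assumes "d \<ge> 2"
  shows "\<exists>f g :: nat \<Rightarrow> (nat \<Rightarrow> bool) \<Rightarrow> bool.
           f \<in> AC0 2 \<and> g \<in> AC0 d - AC0 (d - 1) \<and>
           (\<forall>n. \<forall>\<rho> :: nat \<Rightarrow> bool option.
              restricted n \<rho> (f n) constant_on cube (free_vars n \<rho>) \<longrightarrow>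
              restricted n \<rho> (g n) constant_on cube (free_vars n \<rho>))"
proof -
  define k where "k = d - 1"
  have k: "d = Suc k" "1 \<le> k" using assms unfolding k_def by auto
  obtain h0 where h0: "\<And>n. computes n (Suc k) n (h0 n)"
    "\<not> (\<exists>c. \<forall>n. computes n k ((n + 2) ^ c) (h0 n))"
    using depth_hierarchy[of k] by blast
  have "\<exists>h F W. (h = h0 n \<or> h = (\<lambda>x. \<not> h0 n x)) \<and> layered n F \<and> card F \<le> n \<and>
      W \<subseteq> avail n F k \<and> h = conj_of W" for n
    using computes_conj_form[OF h0(1)[of n]] by metis
  then obtain h F W where h: "\<And>n. h n = h0 n \<or> h n = (\<lambda>x. \<not> h0 n x)"
    and F: "\<And>n. layered n (F n)" "\<And>n. card (F n) \<le> n" "\<And>n. W n \<subseteq> avail n (F n) k"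
    and hW: "\<And>n. h n = conj_of (W n)" by metis
  have h_comp: "computes n (Suc k) n (h n)" for n
    using h[of n] h0(1)[of n] computes_not[OF h0(1)[of n]] by auto
  have h_hard: "\<not> (\<exists>c. \<forall>n. computes n k ((n + 2) ^ c) (h n))"
  proof
    assume "\<exists>c. \<forall>n. computes n k ((n + 2) ^ c) (h n)"
    then obtain c where c: "\<And>n. computes n k ((n + 2) ^ c) (h n)" by blast
    have "computes n k ((n + 2) ^ c) (h0 n)" for n
      using h[of n] c[of n] computes_not[OF c[of n]] by auto
    then show False using h0(2) by blast
  qed
  define g where "g n x \<longleftrightarrow> paired n x \<and> h (n div 2) (\<lambda>i. x (2 * i))" for n x
  have bound: "2 * n + 1 \<le> (n + 2) ^ 2" for n :: nat by (simp add: power2_eq_square)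
  have "computes n 2 ((n + 2) ^ 2) (paired n)" for n
  proof -
    have "computes n (Suc 1) (2 * n + 1) (\<lambda>x. paired n x \<and> conj_of {} (\<lambda>i. x (2 * i)))"
      by (rule computes_and_paired[OF layered_empty]) auto
    moreover have "(\<lambda>x. paired n x \<and> conj_of {} (\<lambda>i. x (2 * i))) = paired n"
      unfolding conj_of_def by simp
    ultimately show ?thesis using computes_mono[OF _ order_refl _ bound] by simp
  qed
  then have "paired \<in> AC0 2" unfolding AC0_iff by blast
  moreover have "g \<in> AC0 d"
  proof -
    have "computes n d ((n + 2) ^ 2) (g n)" for n
      using computes_mono[OF computes_and_paired[OF F k(2)] order_refl order_refl bound]
      unfolding g_def hW k(1) .
    then show ?thesis unfolding AC0_iff by blast
  qed
  moreover have "g \<notin> AC0 (d - 1)"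
  proof
    assume "g \<in> AC0 (d - 1)"
    then obtain c f' where f': "\<And>n. computes n k ((n + 2) ^ c) (f' n)"
      "\<And>n x. x \<in> cube {..<n} \<Longrightarrow> f' n x = g n x"
      unfolding AC0_iff k_def by metis
    have "computes q k ((q + 2) ^ (2 * c)) (h q)" for q
    proof -
      have "computes q k ((2 * q + 2) ^ c) (h q)"
      proof (rule computes_unpair)
        show "computes (2 * q) k ((2 * q + 2) ^ c) (f' (2 * q))" by (rule f'(1))
        show "f' (2 * q) x \<longleftrightarrow> paired (2 * q) x \<and> h q (\<lambda>i. x (2 * i))"
          if "x \<in> cube {..<2 * q}" for x
          using f'(2)[OF that] unfolding g_def by simp
        show "h q x = h q y" if "\<And>i. i < q \<Longrightarrow> x i = y i" for x y
          using that by (rule computes_local[OF h_comp])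
      qed
      moreover have "(2 * q + 2) ^ c \<le> (q + 2) ^ (2 * c)"
        unfolding power_mult by (rule power_mono) (simp_all add: power2_eq_square)
      ultimately show ?thesis by (rule computes_mono[OF _ order_refl order_refl])
    qed
    then show False using h_hard by blast
  qed
  moreover have "restricted n \<rho> (g n) constant_on cube (free_vars n \<rho>)"
    if "restricted n \<rho> (paired n) constant_on cube (free_vars n \<rho>)" for n \<rho>
    using paired_constant_imp[OF that computes_local[OF h_comp]] unfolding g_def .
  ultimately show ?thesis by blast
qed

end
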